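(* Let $q\geq 3$, $0\leq B<1$ and $\Delta\geq 3$, and consider the antiferromagnetic $q$-state Potts model with parameter $B$ on a random $\Delta$-regular bipartite graph (the case $B=0$ being the $q$-colorings model). Then: (1) If $B\geq\frac{\Delta-q}{\Delta}$, there is a unique dominant phase $(\boldsymbol{\alpha},\boldsymbol{\beta})$, and it satisfies $\boldsymbol{\alpha}=\boldsymbol{\beta}$. (2) If $q\geq 4$ is even and $0\leq B<\frac{\Delta-q}{\Delta}$, the dominant phases are in one-to-one correspondence with the subsets $T\subseteq[q]$ with $|T|=q/2$; moreover there exist $a=a(q,\Delta,B)$ and $b=b(q,\Delta,B)$ with $a\neq b$ such that the dominant phase $(\boldsymbol{\alpha},\boldsymbol{\beta})$ corresponding to $T$ satisfies $\alpha_i=a,\ \beta_i=b$ for $i\in T$ and $\alpha_i=b,\ \beta_i=a$ for $i\notin T$. Moreover, these dominant phases are Hessian dominant.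
   Context: The Potts model with parameter $B$ is the $q$-spin system with interaction matrix $\mathbf{B}$ having diagonal entries $B$ and off-diagonal entries $1$. Let $\mathcal{G}_n$ be the distribution on bipartite multigraphs with parts $V_1,V_2$ of size $n$ whose edge multiset is the union of $\Delta$ independent uniformly random perfect matchings. For $\boldsymbol{\alpha},\boldsymbol{\beta}$ in the probability simplex $\triangle_q$, let $Z_G^{\boldsymbol{\alpha},\boldsymbol{\beta}}$ be the total weight $\sum_\sigma\prod_{\{u,v\}\in E}B_{\sigma(u)\sigma(v)}$ of configurations $\sigma:V_1\cup V_2\to[q]$ having (canonically rounded) $\alpha_in$ vertices of $V_1$ and $\beta_in$ vertices of $V_2$ with spin $i$ for each $i$, and $\Psi_1(\boldsymbol{\alpha},\boldsymbol{\beta})=\lim_n\frac1n\log\mathbf{E}_{\mathcal{G}_n}[Z_G^{\boldsymbol{\alpha},\boldsymbol{\beta}}]=\max_{\mathbf{x}}[(\Delta-1)(\sum_i\alpha_i\ln\alpha_i+\sum_j\beta_j\ln\beta_j)+\Delta\sum_{i,j}x_{ij}(\ln B_{ij}-\ln x_{ij})]$, the maximum over nonnegative $\mathbf{x}\in\mathbb{R}^{q\times q}$ with row sums $\alpha_i$ and column sums $\beta_j$ (conventions $\ln0=-\infty$, $0\ln0=0$). A dominant phase is a maximizer of $\Psi_1$ over $\triangle_q\times\triangle_q$; it is Hessian dominant if the Hessian of $\Psi_1$ there, restricted to directions preserving $\sum_i\alpha_i=\sum_j\beta_j=1$, is negative definite. *)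

theory Defs
  imports "HOL-Analysis.Analysis"
begin

text \<open>Spins are the elements of a finite type 'q, so q = CARD('q).
  Phases are pairs (alpha, beta) of vectors in real^'q.\<close>

type_synonym 'q phase = "(real ^ 'q) \<times> (real ^ 'q)"

definition potts_int :: "real \<Rightarrow> 'q::finite \<Rightarrow> 'q \<Rightarrow> real" where
  "potts_int B i j = (if i = j then B else 1)"

definition prob_simplex :: "(real ^ 'q::finite) set" where
  "prob_simplex = {a. (\<forall>i. 0 \<le> a $ i) \<and> (\<Sum>i\<in>UNIV. a $ i) = 1}"

definition plogp :: "real \<Rightarrow> real" where
  "plogp t = (if t = 0 then 0 else t * ln t)"

text \<open>Admissible x: nonnegative, row sums alpha, column sums beta. Since ln 0 = -\<infinity>,
  any x with x_ij > 0 where B_ij = 0 has objective -\<infinity>; we exclude such x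
  (equivalent for the maximum).\<close>
definition admissible :: "real \<Rightarrow> ('q::finite) phase \<Rightarrow> real ^ 'q ^ 'q \<Rightarrow> bool" where
  "admissible B p x \<longleftrightarrow>
     (\<forall>i j. 0 \<le> x $ i $ j) \<and>
     (\<forall>i. (\<Sum>j\<in>UNIV. x $ i $ j) = fst p $ i) \<and>
     (\<forall>j. (\<Sum>i\<in>UNIV. x $ i $ j) = snd p $ j) \<and>
     (\<forall>i j. potts_int B i j = 0 \<longrightarrow> x $ i $ j = 0)"

definition psi_obj :: "nat \<Rightarrow> real \<Rightarrow> ('q::finite) phase \<Rightarrow> real ^ 'q ^ 'q \<Rightarrow> real" where
  "psi_obj \<Delta> B p x =
     (real \<Delta> - 1) * ((\<Sum>i\<in>UNIV. plogp (fst p $ i)) + (\<Sum>j\<in>UNIV. plogp (snd p $ j)))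
     + real \<Delta> * (\<Sum>i\<in>UNIV. \<Sum>j\<in>UNIV.
          (if x $ i $ j = 0 then 0 else x $ i $ j * ln (potts_int B i j) - plogp (x $ i $ j)))"

text \<open>Psi_1 as the supremum (a maximum, by compactness) over admissible x;
  it is -\<infinity> if there is no admissible x.\<close>
definition Psi1 :: "nat \<Rightarrow> real \<Rightarrow> ('q::finite) phase \<Rightarrow> ereal" where
  "Psi1 \<Delta> B p = (SUP x\<in>{x. admissible B p x}. ereal (psi_obj \<Delta> B p x))"

definition dominant_phase :: "nat \<Rightarrow> real \<Rightarrow> ('q::finite) phase \<Rightarrow> bool" where
  "dominant_phase \<Delta> B p \<longleftrightarrow>
     p \<in> prob_simplex \<times> prob_simplex \<and>
     (\<forall>p' :: 'q phase \<in> prob_simplex \<times> prob_simplex. Psi1 \<Delta> B p' \<le> Psi1 \<Delta> B p)"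

definition tangent_dirs :: "('q::finite) phase set" where
  "tangent_dirs = {w. (\<Sum>i\<in>UNIV. fst w $ i) = 0 \<and> (\<Sum>i\<in>UNIV. snd w $ i) = 0}"

definition sum_one_plane :: "('q::finite) phase set" where
  "sum_one_plane = {p. (\<Sum>i\<in>UNIV. fst p $ i) = 1 \<and> (\<Sum>i\<in>UNIV. snd p $ i) = 1}"

definition hessian_dominant :: "nat \<Rightarrow> real \<Rightarrow> ('q::finite) phase \<Rightarrow> bool" where
  "hessian_dominant \<Delta> B p \<longleftrightarrow>
     dominant_phase \<Delta> B p \<and>
     (\<forall>\<^sub>F y in at p within sum_one_plane. Psi1 \<Delta> B y \<noteq> -\<infinity> \<and> Psi1 \<Delta> B y \<noteq> \<infinity>) \<and>
     (\<exists>(Df :: 'q phase \<Rightarrow> 'q phase \<Rightarrow>\<^sub>L real) (D2 :: 'q phase \<Rightarrow> 'q phase \<Rightarrow>\<^sub>L real).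
        (\<forall>\<^sub>F y in at p within sum_one_plane.
           ((\<lambda>z. real_of_ereal (Psi1 \<Delta> B z)) has_derivative blinfun_apply (Df y))
             (at y within sum_one_plane)) \<and>
        ((\<lambda>z. real_of_ereal (Psi1 \<Delta> B z)) has_derivative blinfun_apply (Df p))
             (at p within sum_one_plane) \<and>
        (Df has_derivative (\<lambda>w. D2 w)) (at p within sum_one_plane) \<and>
        (\<forall>w\<in>tangent_dirs. w \<noteq> 0 \<longrightarrow> blinfun_apply (D2 w) w < 0))"

end

theory Submission
  imports Defs
begin

text \<open>
  Put n = \<Delta> - 1, d = 1 - B and write \<alpha>_i = X_i^(n+1), \<beta>_j = Y_j^(n+1).  Gibbs' inequality for the
  inner maximization gives Psi1 <= \<Delta> ln F with F = sum_ij B_ij X_i^n Y_j^n, with equality where the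
  matrix B_ij X_i^n Y_j^n / F has marginals \<alpha>, \<beta>; so it suffices to maximize the bilinear form
  F = (sum X^n) (sum Y^n) - d sum X^n Y^n under sum X^(n+1) = sum Y^(n+1) = 1.

  By AM-GM the product of the two sums is at most the square of their mean; after rescaling this
  mean to 1, the problem decouples over the spins, and each spin contributes a two-variable
  Lagrangian lag(x_i, y_i).  Its global maximum is attained only at a pair (x0, y0) and its mirror
  image: maximizing over one variable leaves a function whose derivative has the sign of the
  two-step tree recursion minus the identity, which changes sign at most three times.  If
  d \<Delta> <= q the pair is diagonal, so all spins agree; otherwise x0 > y0, and equality of the two
  sums forces exactly half of the spins onto each of the two maximizers.

  For the Hessian, the optimal x is B_ij exp(f_i + g_j), where (f, g) is obtained from the phase by
  the inverse function theorem applied to the gradient of the dual potential.  Negative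
  definiteness reduces to a quadratic form in the phase alone, which decouples over the spins
  except for a rank-one term and is handled by averaging.
\<close>

subsection \<open>Elementary inequalities\<close>

text \<open>The obstacle is that the product of the two power sums couples all spins. Replacing it
  by the square of the mean loses exactly the square of half the difference of the sums; for two
  distinct spin values this loss vanishes only on a balanced partition, which is where even
  \<open>q\<close> enters. The form has degree 2n while the constraints have degree n+1, so a common
  scale of X and Y remains free after the spins decouple; a one-variable Bernoulli inequality
  disposes of it.

  The threshold is the loss of stability of the tree recursion. At its fixed point s with q s^n = 1
  the slope is - n d s^(n-1) / k, and k s = 1 - d s^n turns "modulus at most 1" into d \<Delta> <=
  q. Beyond that the fixed point is accompanied by the 2-cycle x0, y0. As the recursion reverses
  order, the two-step map has to be studied on one side of the fixed point only.

  For B = 0 the diagonal of the edge matrix vanishes, so nondegeneracy of the dual problem must come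
  from the off-diagonal entries. The Hessian repeats the AM-GM step infinitesimally: the product of
  two linear forms is bounded by the square of their sum, the rank-one term.\<close>

lemma young_power:
  fixes y z :: real
  assumes "0 \<le> y" "0 \<le> z"
  shows "real (n + 1) * y ^ n * z \<le> real n * y ^ (n + 1) + z ^ (n + 1)"
proof (induction n)
  case 0
  then show ?case by simp
next
  case (Suc n)
  \<comment> \<open>Both factors have the same sign. This product is exactly what is missing between
    \<open>y\<close> times the induction hypothesis and the goal.\<close>
  have "0 \<le> (y ^ Suc n - z ^ Suc n) * (y - z)"
    using assms power_mono[of y z "Suc n"] power_mono[of z y "Suc n"]
    by (cases "y \<le> z") (auto intro: mult_nonneg_nonneg mult_nonpos_nonpos simp del: power_Suc)
  then show ?case
    using mult_left_mono[OF Suc.IH assms(1)] by (simp add: algebra_simps)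
qed

lemma young_power_strict:
  fixes y z :: real
  assumes "0 \<le> y" "0 \<le> z" "y \<noteq> z" "0 < n"
  shows "real (n + 1) * y ^ n * z < real n * y ^ (n + 1) + z ^ (n + 1)"
proof -
  obtain m where n: "n = Suc m" using \<open>0 < n\<close> gr0_implies_Suc by blast
  have "0 < (y ^ n - z ^ n) * (y - z)"
    using assms power_strict_mono[of y z n] power_strict_mono[of z y n]
    by (cases "y < z") (auto intro: mult_pos_pos mult_neg_neg)
  then show ?thesis
    using mult_left_mono[OF young_power[OF assms(1,2), of m] assms(1)]
    unfolding n by (simp add: algebra_simps)
qed

text \<open>Weighted AM-GM between \<open>t ^ N\<close> and \<open>1\<close>. With
  \<open>m = n - 1\<close> and \<open>N = 2 * n\<close> it later settles the optimal common scale,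
  attained at \<open>t = 1\<close>.\<close>

lemma bernoulli_interpolation:
  fixes t :: real
  assumes "0 \<le> t" "m \<le> N"
  shows "real N * t ^ m \<le> real m * t ^ N + real (N - m)"
  using \<open>m \<le> N\<close>
proof (induction N rule: dec_induct)
  case base
  then show ?case by simp
next
  case (step N)
  have Y: "real (N + 1) * t ^ N \<le> real N * t ^ (N + 1) + 1"
    using young_power[OF \<open>0 \<le> t\<close>, of 1 N] by simp
  show ?case
  proof (cases "N = 0")
    case True
    then show ?thesis using step by simp
  next
    case False
    have "real N * (real (Suc N) * t ^ m) = real (Suc N) * (real N * t ^ m)" by simp
    also have "\<dots> \<le> real (Suc N) * (real m * t ^ N + real (N - m))"
      using step.IH by (intro mult_left_mono) auto
    also have "\<dots> = real m * (real (N + 1) * t ^ N) + real (Suc N) * (real N - real m)"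
      using step by (simp add: algebra_simps of_nat_diff)
    also have "\<dots> \<le> real m * (real N * t ^ (N + 1) + 1) + real (Suc N) * (real N - real m)"
      using Y by (intro add_right_mono mult_left_mono) auto
    also have "\<dots> = real N * (real m * t ^ Suc N + real (Suc N - m))"
      using step by (simp add: algebra_simps of_nat_diff)
    finally show ?thesis using False by (simp del: power_Suc)
  qed
qed

text \<open>The complete homogeneous symmetric polynomial of degree \<open>n\<close> in two
  variables, that is, the divided difference of the power \<open>Suc n\<close>. As a polynomial it
  also makes sense for \<open>x = y\<close>.\<close>

definition hsym :: "nat \<Rightarrow> real \<Rightarrow> real \<Rightarrow> real" where
  "hsym n x y = (\<Sum>i\<le>n. x ^ i * y ^ (n - i))"

lemma hsym_Suc: "hsym (Suc n) x y = x * hsym n x y + y ^ Suc n"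
  unfolding hsym_def sum.atMost_Suc_shift by (simp add: sum_distrib_left mult_ac)

lemma hsym_commute: "hsym n x y = hsym n y x"
  unfolding hsym_def
  by (rule sum.reindex_bij_witness[of _ "\<lambda>i. n - i" "\<lambda>i. n - i"]) (auto simp: mult.commute)

lemma hsym_diff: "(x - y) * hsym n x y = x ^ Suc n - y ^ Suc n"
proof (induction n)
  case (Suc n)
  have "(x - y) * hsym (Suc n) x y = x * ((x - y) * hsym n x y) + (x - y) * y ^ Suc n"
    by (simp add: hsym_Suc algebra_simps)
  also have "\<dots> = x ^ Suc (Suc n) - y ^ Suc (Suc n)"
    unfolding Suc.IH by (simp add: algebra_simps)
  finally show ?case .
qed (simp add: hsym_def)

lemma hsym_pos: "0 < x \<Longrightarrow> 0 < y \<Longrightarrow> 0 < hsym n x y"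
  unfolding hsym_def by (intro sum_pos) auto

lemma hsym_scale: "hsym n (c * x) (c * y) = c ^ n * hsym n x y"
  unfolding hsym_def sum_distrib_left
  by (intro sum.cong refl) (simp add: power_mult_distrib flip: power_add)

text \<open>The terms with indices \<open>i\<close> and \<open>m - i\<close> have geometric mean
  \<open>(u * v) ^ m\<close>, so each such pair sums to twice this value plus a square, and the
  square for \<open>i = 0\<close> is positive. Squared arguments keep the geometric means
  polynomial.\<close>

lemma hsym_gt_geometric:
  fixes u v :: real
  assumes "0 < u" "0 < v" "u \<noteq> v" "0 < m"
  shows "real (m + 1) * (u * v) ^ m < hsym m (u\<^sup>2) (v\<^sup>2)"
proof -
  have pair: "2 * (u * v) ^ m + (u ^ i * v ^ (m - i) - u ^ (m - i) * v ^ i)\<^sup>2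
      = (u\<^sup>2) ^ i * (v\<^sup>2) ^ (m - i) + (u\<^sup>2) ^ (m - i) * (v\<^sup>2) ^ i" if "i \<le> m" for i
  proof -
    have uv: "(u * v) ^ m = (u ^ i * v ^ (m - i)) * (u ^ (m - i) * v ^ i)"
    proof -
      have "u ^ m = u ^ i * u ^ (m - i)" "v ^ m = v ^ i * v ^ (m - i)"
        using that by (simp_all flip: power_add)
      then show ?thesis by (simp add: power_mult_distrib)
    qed
    show ?thesis unfolding uv power_mult[symmetric] mult.commute[of 2]
      by (simp only: power_mult power2_diff) (simp add: power_mult_distrib power2_eq_square algebra_simps)
  qed
  let ?D = "\<lambda>i. (u ^ i * v ^ (m - i) - u ^ (m - i) * v ^ i)\<^sup>2"
  have "2 * hsym m (u\<^sup>2) (v\<^sup>2) = hsym m (u\<^sup>2) (v\<^sup>2) + hsym m (v\<^sup>2) (u\<^sup>2)"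
    using hsym_commute by simp
  also have "\<dots> = (\<Sum>i\<le>m. 2 * (u * v) ^ m + ?D i)"
    unfolding hsym_def sum.distrib[symmetric] using pair by (intro sum.cong) (auto simp: mult.commute)
  also have "\<dots> = 2 * (real (m + 1) * (u * v) ^ m) + (\<Sum>i\<le>m. ?D i)"
    by (simp add: sum.distrib)
  finally have eq: "2 * hsym m (u\<^sup>2) (v\<^sup>2) = \<dots>" .
  have "u ^ m \<noteq> v ^ m"
    using assms by (simp add: power_eq_iff_eq_base)
  then have "0 < ?D 0" by simp
  then have "0 < (\<Sum>i\<le>m. ?D i)"
    by (intro sum_pos2[where i=0]) auto
  with eq show ?thesis by simp
qed

subsection \<open>The two-spin Lagrangian\<close>

text \<open>Here n = \<Delta> - 1 and d = 1 - B.  The pair (x0, y0) is a critical point of the two-spin Lagrangian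
  \<open>lag\<close> below, k being its multiplier; \<open>eta\<close> is the tree recursion in the coordinates whose n-th
  powers are the messages, and \<open>phi\<close> vanishes at the fixed points of its square.\<close>

locale crit_pair =
  fixes n :: nat and d k x0 y0 :: real
  assumes n: "2 \<le> n" and d: "0 < d" and k: "0 < k" and y0: "0 < y0" and le: "y0 \<le> x0"
    and crit_x: "1 - d * y0 ^ n = k * x0" and crit_y: "1 - d * x0 ^ n = k * y0"
    and d_less: "d < k ^ n"
    and diag: "x0 = y0 \<Longrightarrow> d * real (n + 1) * x0 ^ n \<le> 1"
begin

definition eta :: "real \<Rightarrow> real" where "eta u = (1 - d * u ^ n) / k"
definition phi :: "real \<Rightarrow> real" where "phi u = 1 - d * eta u ^ n - k * u"
definition psi :: "real \<Rightarrow> real" where "psi u = u * eta u"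
definition dphi :: "real \<Rightarrow> real" where "dphi u = (real n * d)\<^sup>2 / k * psi u ^ (n - 1) - k"
text \<open>Chosen so that the derivative of \<open>lag u v\<close> in \<open>u\<close> is
  \<open>n * u ^ (n - 1) * (1 - d * v ^ n - k * u)\<close>; its positive critical points then solve
  the two equations of the locale.\<close>

definition kp :: real where "kp = k / real (n + 1)"
definition lag :: "real \<Rightarrow> real \<Rightarrow> real" where
  "lag u v = u ^ n + v ^ n - d * u ^ n * v ^ n - real n * kp * (u ^ (n + 1) + v ^ (n + 1))"
text \<open>The value of \<open>lag u v\<close> at \<open>v = eta u\<close>, which is its maximum
  over nonnegative \<open>v\<close> as long as \<open>eta u\<close> is nonnegative.\<close>

definition env :: "real \<Rightarrow> real" where
  "env u = u ^ n - real n * kp * u ^ (n + 1) + kp * eta u ^ (n + 1)"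

lemma k_kp: "k = real n * kp + kp" and kp: "0 < kp"
proof -
  have "kp * real (n + 1) = k" by (simp add: kp_def)
  then show "k = real n * kp + kp" by (simp add: algebra_simps)
  show "0 < kp" using k by (simp add: kp_def)
qed

lemma k_eta: "k * eta u = 1 - d * u ^ n"
  using k by (simp add: eta_def)

lemma eta_x0: "eta x0 = y0" and eta_y0: "eta y0 = x0"
  using k crit_x crit_y by (auto simp: eta_def field_simps)

lemma x0: "0 < x0" using y0 le by simp

lemma eta_strict_antimono: "0 \<le> u \<Longrightarrow> u < v \<Longrightarrow> eta v < eta u"
  using n d k power_strict_mono[of u v n] by (simp add: eta_def divide_strict_right_mono)

lemma eta_antimono: "0 \<le> u \<Longrightarrow> u \<le> v \<Longrightarrow> eta v \<le> eta u"
  using eta_strict_antimono[of u v] by (cases "u = v") auto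

lemma phi_eq: "phi u = k * (eta (eta u) - u)"
  using k_eta[of "eta u"] by (simp add: phi_def algebra_simps)

lemma DERIV_eta: "(eta has_real_derivative - (d * real n * u ^ (n - 1) / k)) (at u)"
  unfolding eta_def [abs_def] using k by (auto intro!: derivative_eq_intros simp: mult_ac)

lemma DERIV_psi: "(psi has_real_derivative (1 - d * real (n + 1) * u ^ n) / k) (at u)"
proof -
  have "u * u ^ (n - 1) = u ^ n" using n by (simp flip: power_Suc)
  then have *: "u * (real n * (d * u ^ (n - 1))) = real n * (d * u ^ n)" by (simp add: mult_ac)
  show ?thesis
    unfolding psi_def [abs_def] using k *
    by (auto intro!: derivative_eq_intros DERIV_eta simp: eta_def field_simps)
qed

lemma DERIV_phi: "(phi has_real_derivative dphi u) (at u)"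
proof -
  have "real n * d * eta u ^ (n - 1) * (d * real n * u ^ (n - 1) / k) = (real n * d)\<^sup>2 / k * psi u ^ (n - 1)"
    by (simp add: psi_def power_mult_distrib power2_eq_square)
  then show ?thesis
    unfolding phi_def [abs_def] dphi_def using k
    by (auto intro!: derivative_eq_intros DERIV_eta simp: mult_ac)
qed

text \<open>Envelope principle: \<open>eta u\<close> is critical in the second variable, so only the
  partial derivative of \<open>lag\<close> in the first one survives.\<close>

lemma DERIV_env: "(env has_real_derivative real n * u ^ (n - 1) * phi u) (at u)"
proof -
  have u: "u * u ^ (n - 1) = u ^ n" using n by (simp flip: power_Suc)
  have "(env has_real_derivative real n * u ^ (n - 1) - real n * kp * (real (n + 1) * u ^ n)
      + kp * (real (n + 1) * eta u ^ n * - (d * real n * u ^ (n - 1) / k))) (at u)"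
    unfolding env_def [abs_def]
    using DERIV_add[OF DERIV_diff[OF DERIV_pow[of n u UNIV] DERIV_cmult[OF DERIV_pow[of "n + 1" u UNIV], of "real n * kp"]]
        DERIV_cmult[OF DERIV_power[OF DERIV_eta[of u], of "n + 1"], of kp]]
    by (simp add: mult_ac del: power_Suc)
  also have "real n * u ^ (n - 1) - real n * kp * (real (n + 1) * u ^ n)
      + kp * (real (n + 1) * eta u ^ n * - (d * real n * u ^ (n - 1) / k))
      = real n * u ^ (n - 1) - (kp * real (n + 1)) * real n * u ^ n
        - (kp * real (n + 1) / k) * eta u ^ n * (d * real n * u ^ (n - 1))"
    by (simp del: of_nat_Suc of_nat_add)
  also have "kp * real (n + 1) = k" by (simp add: kp_def)
  also have "real n * u ^ (n - 1) - k * real n * u ^ n - (k / k) * eta u ^ n * (d * real n * u ^ (n - 1))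
      = real n * u ^ (n - 1) * phi u"
    using k unfolding phi_def u[symmetric] by (simp add: algebra_simps)
  finally show ?thesis .
qed

lemma env_increasing:
  assumes "0 \<le> a" "a < b" "\<And>u. a < u \<Longrightarrow> u < b \<Longrightarrow> 0 < phi u"
  shows "env a < env b"
  using \<open>a < b\<close>
proof (rule DERIV_pos_imp_increasing_open)
  show "\<exists>y. (env has_real_derivative y) (at u) \<and> 0 < y" if "a < u" "u < b" for u
    using assms that n by (intro exI[of _ "real n * u ^ (n - 1) * phi u"] conjI DERIV_env) auto
  show "continuous_on {a..b} env"
    by (meson DERIV_continuous_on DERIV_env has_field_derivative_at_within)
qed

lemma env_decreasing:
  assumes "0 \<le> a" "a < b" "\<And>u. a < u \<Longrightarrow> u < b \<Longrightarrow> phi u < 0"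
  shows "env b < env a"
  using \<open>a < b\<close>
proof (rule DERIV_neg_imp_decreasing_open)
  show "\<exists>y. (env has_real_derivative y) (at u) \<and> y < 0" if "a < u" "u < b" for u
    using assms that n by (intro exI[of _ "real n * u ^ (n - 1) * phi u"] conjI DERIV_env) (auto simp: mult_pos_neg)
  show "continuous_on {a..b} env"
    by (meson DERIV_continuous_on DERIV_env has_field_derivative_at_within)
qed

lemma phi_increasing:
  assumes "a < b" "\<And>u. a < u \<Longrightarrow> u < b \<Longrightarrow> 0 < dphi u"
  shows "phi a < phi b"
  using \<open>a < b\<close>
proof (rule DERIV_pos_imp_increasing_open)
  show "continuous_on {a..b} phi"
    by (meson DERIV_continuous_on DERIV_phi has_field_derivative_at_within)
qed (use assms DERIV_phi in blast)

lemma phi_decreasing: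
  assumes "a < b" "\<And>u. a < u \<Longrightarrow> u < b \<Longrightarrow> dphi u < 0"
  shows "phi b < phi a"
  using \<open>a < b\<close>
proof (rule DERIV_neg_imp_decreasing_open)
  show "continuous_on {a..b} phi"
    by (meson DERIV_continuous_on DERIV_phi has_field_derivative_at_within)
qed (use assms DERIV_phi in blast)

lemma dphi_less:
  assumes "0 \<le> psi a" "psi a < psi b"
  shows "dphi a < dphi b"
proof -
  have "psi a ^ (n - 1) < psi b ^ (n - 1)"
    using assms n by (intro power_strict_mono) auto
  moreover have "0 < (real n * d)\<^sup>2 / k" using n d k by simp
  ultimately show ?thesis unfolding dphi_def by (simp del: times_divide_eq_left)
qed

text \<open>Since the derivative of \<open>phi\<close> is an increasing function of \<open>psi\<close>, quasiconcavity of \<open>psi\<close> limits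
  the sign changes of \<open>phi\<close> and hence the critical points of \<open>env\<close>.\<close>
lemma psi_quasiconcave:
  assumes "0 \<le> u" "u < w" "w < z" "psi w \<le> psi u"
  shows "psi z < psi w"
proof -
  obtain \<xi> where \<xi>: "u < \<xi>" "\<xi> < w" "psi w - psi u = (w - u) * ((1 - d * real (n + 1) * \<xi> ^ n) / k)"
    using MVT2[OF \<open>u < w\<close>, of psi "\<lambda>u. (1 - d * real (n + 1) * u ^ n) / k"] DERIV_psi by blast
  have neg: "1 - d * real (n + 1) * \<xi> ^ n \<le> 0"
    using \<xi> assms k by (smt (verit) divide_pos_pos mult_pos_pos)
  obtain \<zeta> where \<zeta>: "w < \<zeta>" "\<zeta> < z" "psi z - psi w = (z - w) * ((1 - d * real (n + 1) * \<zeta> ^ n) / k)"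
    using MVT2[OF \<open>w < z\<close>, of psi "\<lambda>u. (1 - d * real (n + 1) * u ^ n) / k"] DERIV_psi by blast
  have "\<xi> ^ n < \<zeta> ^ n" using \<xi> \<zeta> assms n by (intro power_strict_mono) auto
  then have "d * real (n + 1) * \<xi> ^ n < d * real (n + 1) * \<zeta> ^ n" using d by simp
  with neg have "(1 - d * real (n + 1) * \<zeta> ^ n) / k < 0" using k by (simp add: divide_neg_pos)
  then show ?thesis using \<zeta> by (smt (verit) mult_pos_neg)
qed

lemma psi_nonneg: "0 \<le> u \<Longrightarrow> u \<le> s \<Longrightarrow> 0 \<le> eta s \<Longrightarrow> 0 \<le> psi u"
  using eta_antimono[of u s] by (simp add: psi_def)

section \<open>Signs of the two-step recursion minus the identity\<close>

text \<open>At a fixed point \<open>dphi s \<le> 0\<close> says that the slope of \<open>eta\<close>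
  has modulus at most 1, that is, \<open>n * d * s ^ (n - 1) \<le> k\<close>. Multiplying by
  \<open>s\<close> and inserting \<open>k * s = 1 - d * s ^ n\<close> eliminates
  \<open>k\<close>.\<close>

lemma dphi_fixpoint:
  assumes "0 < s" "eta s = s"
  shows "dphi s \<le> 0 \<longleftrightarrow> d * real (n + 1) * s ^ n \<le> 1"
proof -
  have s: "s * s ^ (n - 1) = s ^ n" using n by (simp flip: power_Suc)
  have "dphi s \<le> 0 \<longleftrightarrow> (real n * d * s ^ (n - 1))\<^sup>2 \<le> k\<^sup>2"
    using k assms unfolding dphi_def psi_def assms
    by (simp add: field_simps power2_eq_square power_mult_distrib)
  also have "\<dots> \<longleftrightarrow> real n * d * s ^ (n - 1) \<le> k"
    using k d assms by (subst power_mono_iff) auto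
  also have "\<dots> \<longleftrightarrow> s * (real n * d * s ^ (n - 1)) \<le> s * k"
    using assms by (simp only: mult_le_cancel_left_pos)
  also have "s * (real n * d * s ^ (n - 1)) = real n * d * s ^ n"
    unfolding s[symmetric] by simp
  also have "s * k = 1 - d * s ^ n" using k_eta[of s] assms by (simp add: mult.commute)
  finally show ?thesis by (simp add: algebra_simps)
qed

lemma phi_fixpoint: "eta s = s \<Longrightarrow> phi s = 0"
  by (simp add: phi_eq)

text \<open>Below \<open>s\<close> the derivative of \<open>psi\<close> is positive, so
  \<open>dphi\<close> stays below \<open>dphi s \<le> 0\<close> and \<open>phi\<close> decreases
  strictly to its zero at \<open>s\<close>.\<close>

lemma phi_pos_below_diag:
  assumes "0 \<le> u" "u < s" "eta s = s" "d * real (n + 1) * s ^ n \<le> 1"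
  shows "0 < phi u"
proof -
  have "dphi v < 0" if "u < v" "v < s" for v
  proof -
    have "psi v < psi s"
    proof -
      obtain \<zeta> where \<zeta>: "v < \<zeta>" "\<zeta> < s" "psi s - psi v = (s - v) * ((1 - d * real (n + 1) * \<zeta> ^ n) / k)"
        using MVT2[OF \<open>v < s\<close>, of psi "\<lambda>u. (1 - d * real (n + 1) * u ^ n) / k"] DERIV_psi by blast
      have "\<zeta> ^ n < s ^ n" using \<zeta> that assms n by (intro power_strict_mono) auto
      then have "d * real (n + 1) * \<zeta> ^ n < d * real (n + 1) * s ^ n" using d by simp
      with assms have "0 < (1 - d * real (n + 1) * \<zeta> ^ n) / k" using k by simp
      then show ?thesis using \<zeta> by (smt (verit) mult_pos_pos)
    qed
    then have "dphi v < dphi s" using that assms by (intro dphi_less psi_nonneg[of _ s]) auto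
    also have "\<dots> \<le> 0" using dphi_fixpoint assms by auto
    finally show ?thesis .
  qed
  then show ?thesis using phi_decreasing[OF \<open>u < s\<close>] phi_fixpoint assms by auto
qed

text \<open>Since \<open>eta\<close> reverses order, it reverses the sign of \<open>phi\<close> as
  well. This and the next lemma transport the analysis below the fixed point to the region above
  it.\<close>

lemma phi_mirror_neg:
  assumes "0 \<le> u" "0 < phi (eta u)"
  shows "phi u < 0"
proof (rule ccontr)
  assume "\<not> phi u < 0"
  then have "u \<le> eta (eta u)" using k by (simp add: phi_eq mult_less_0_iff)
  then have "eta (eta (eta u)) \<le> eta u" using assms by (intro eta_antimono) auto
  then show False using assms k by (simp add: phi_eq zero_less_mult_iff)
qed

lemma phi_mirror_pos:
  assumes "0 \<le> eta (eta u)" "phi (eta u) < 0"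
  shows "0 < phi u"
proof (rule ccontr)
  assume "\<not> 0 < phi u"
  then have "eta (eta u) \<le> u" using k by (simp add: phi_eq zero_less_mult_iff)
  then have "eta u \<le> eta (eta (eta u))" using assms by (intro eta_antimono) auto
  then show False using assms k by (simp add: phi_eq mult_less_0_iff)
qed

lemma fixpoint_between:
  assumes "y0 < x0"
  obtains s where "y0 < s" "s < x0" "eta s = s"
proof -
  have "continuous_on {y0..x0} (\<lambda>s. s - eta s)"
    by (intro continuous_on_diff continuous_on_id DERIV_continuous_on[OF has_field_derivative_at_within[OF DERIV_eta]])
  then have "\<exists>s\<ge>y0. s \<le> x0 \<and> s - eta s = 0"
    using le by (intro IVT') (auto simp: eta_x0 eta_y0)
  then obtain s where s: "y0 \<le> s" "s \<le> x0" "eta s = s" by auto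
  moreover have "s \<noteq> y0" "s \<noteq> x0" using s assms eta_x0 eta_y0 by auto
  ultimately show ?thesis using that[of s] by simp
qed

text \<open>Below \<open>s\<close>, \<open>dphi\<close> can change sign only once, from negative to
  positive. Thus \<open>phi\<close> first falls and then rises, and its two zeros \<open>y0\<close>
  and \<open>s\<close> determine all signs.\<close>

lemma phi_signs_below:
  assumes "y0 < s" "s < x0" "eta s = s"
  shows "0 \<le> u \<Longrightarrow> u < y0 \<Longrightarrow> 0 < phi u" and "y0 < u \<Longrightarrow> u < s \<Longrightarrow> phi u < 0"
proof -
  have s: "0 < s" using assms y0 by simp
  have phi_y0: "phi y0 = 0" by (simp add: phi_eq eta_x0 eta_y0)
  have phi_s: "phi s = 0" using assms phi_fixpoint by simp
  \<comment> \<open>Otherwise the fixed point would be stable and \<open>phi\<close> positive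
    everywhere below it, contradicting the zero at \<open>y0\<close>.\<close>
  have dphi_s: "0 < dphi s"
  proof (rule ccontr)
    assume "\<not> 0 < dphi s"
    then have "d * real (n + 1) * s ^ n \<le> 1" using dphi_fixpoint[OF s] assms by linarith
    then show False using phi_pos_below_diag[of y0 s] assms y0 phi_y0 by auto
  qed
  have nn: "0 \<le> psi v" if "0 \<le> v" "v \<le> s" for v using psi_nonneg that s assms by auto
  \<comment> \<open>From \<open>dphi w \<le> 0 < dphi s\<close> follows
    \<open>psi w < psi s\<close>. Quasiconcavity then forbids \<open>psi\<close> to have been at
    least \<open>psi w\<close> at an earlier \<open>v\<close>.\<close>
  have left: "dphi v < 0" if "dphi w \<le> 0" "0 \<le> v" "v < w" "w < s" for v w
  proof -
    have ws: "psi w < psi s"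
    proof (rule ccontr)
      assume "\<not> psi w < psi s"
      then have "psi s = psi w \<or> psi s < psi w" by auto
      then have "dphi s \<le> dphi w" using dphi_less[of s w] nn[of s] s by (auto simp: dphi_def)
      with that dphi_s show False by simp
    qed
    have "psi v < psi w" using psi_quasiconcave[of v w s] that ws by fastforce
    then have "dphi v < dphi w" using nn that by (intro dphi_less) auto
    with that show ?thesis by simp
  qed
  have right: "0 < dphi v" if "0 < dphi w" "0 \<le> w" "w < v" "v < s" for v w
    using left[of v w] that by fastforce
  have dphi_y0: "dphi y0 \<le> 0"
  proof (rule ccontr)
    assume "\<not> dphi y0 \<le> 0"
    then have "phi y0 < phi s" using right[of y0] y0 assms by (intro phi_increasing) auto
    then show False using phi_y0 phi_s by simp
  qed
  show "0 < phi u" if "0 \<le> u" "u < y0"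
  proof -
    have "phi y0 < phi u"
      using left[OF dphi_y0] that assms by (intro phi_decreasing) auto
    then show ?thesis using phi_y0 by simp
  qed
  show "phi u < 0" if "y0 < u" "u < s"
  proof (cases "dphi u \<le> 0")
    case True
    then have "phi u < phi y0" using left[OF True] that y0 by (intro phi_decreasing) auto
    then show ?thesis using phi_y0 by simp
  next
    case False
    then have "phi u < phi s" using right[of u] that y0 by (intro phi_increasing) auto
    then show ?thesis using phi_s by simp
  qed
qed

section \<open>The global maximum of the Lagrangian\<close>

lemma env_eq_lag: "env u = lag u (eta u)"
proof -
  have "lag u (eta u) = u ^ n + eta u ^ n * (k * eta u) - real n * kp * (u ^ (n + 1) + eta u ^ (n + 1))"
    unfolding k_eta lag_def by (simp add: algebra_simps)
  also have "\<dots> = env u" unfolding env_def by (subst k_kp) (simp add: algebra_simps)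
  finally show ?thesis by simp
qed

lemma lag_commute: "lag u v = lag v u"
  by (simp add: lag_def algebra_simps)

lemma env_x0: "env x0 = lag x0 y0" and env_y0: "env y0 = lag x0 y0"
  using env_eq_lag eta_x0 eta_y0 lag_commute by auto

text \<open>The difference of the two sides is \<open>kp\<close> times the deficit in Young's
  inequality for \<open>v\<close> and \<open>eta u\<close>, which vanishes only at
  \<open>v = eta u\<close>.\<close>

lemma lag_le_env:
  assumes "0 \<le> v" "0 \<le> eta u"
  shows "lag u v \<le> env u" and "lag u v = env u \<Longrightarrow> v = eta u"
proof -
  have diff: "env u - lag u v = kp * (real n * v ^ (n + 1) + eta u ^ (n + 1) - real (n + 1) * v ^ n * eta u)"
  proof -
    have "lag u v = u ^ n + v ^ n * (k * eta u) - real n * kp * (u ^ (n + 1) + v ^ (n + 1))"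
      unfolding k_eta lag_def by (simp add: algebra_simps)
    also have "\<dots> = u ^ n + v ^ n * ((real n * kp + kp) * eta u) - real n * kp * (u ^ (n + 1) + v ^ (n + 1))"
      using k_kp by simp
    finally show ?thesis unfolding env_def by (simp add: algebra_simps)
  qed
  show "lag u v \<le> env u"
    using mult_nonneg_nonneg[of kp "real n * v ^ (n + 1) + eta u ^ (n + 1) - real (n + 1) * v ^ n * eta u"]
      young_power[OF assms, of n] diff kp by linarith
  show "v = eta u" if "lag u v = env u"
  proof (rule ccontr)
    assume "v \<noteq> eta u"
    then have "0 < kp * (real n * v ^ (n + 1) + eta u ^ (n + 1) - real (n + 1) * v ^ n * eta u)"
      using young_power_strict[OF assms] n kp by (intro mult_pos_pos) auto
    with diff that show False by linarith
  qed
qed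

text \<open>In the diagonal case \<open>env\<close> has a single peak at \<open>x0\<close>.
  Otherwise it has peaks at \<open>y0\<close> and \<open>x0\<close> with a valley at the fixed point
  between them, and the peaks are equally high because \<open>lag\<close> is symmetric.
  Nonnegativity of \<open>eta u\<close> keeps all mirrored points in the range where the signs of
  \<open>phi\<close> are known.\<close>

lemma env_le:
  assumes "0 \<le> u" "0 \<le> eta u"
  shows "env u \<le> lag x0 y0" and "env u = lag x0 y0 \<Longrightarrow> u = x0 \<or> u = y0"
proof -
  have "env u < lag x0 y0" if "u \<noteq> x0" "u \<noteq> y0"
  proof (cases "x0 = y0")
    case True
    have s: "eta x0 = x0" using True eta_x0 by simp
    have pos: "0 < phi v" if "0 \<le> v" "v < x0" for v
      using phi_pos_below_diag[OF that s diag[OF True]] .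
    show ?thesis
    proof (cases "u < x0")
      case True
      then show ?thesis using env_increasing[of u x0] pos assms env_x0 by auto
    next
      case False
      have "phi v < 0" if "x0 < v" "v < u" for v
      proof (rule phi_mirror_neg)
        show "0 < phi (eta v)"
          using eta_strict_antimono[of x0 v] eta_antimono[of v u] that x0 assms s by (intro pos) auto
      qed (use that x0 in auto)
      then show ?thesis using env_decreasing[of x0 u] False that x0 env_x0 by auto
    qed
  next
    case False
    then have "y0 < x0" using le by simp
    then obtain s where s: "y0 < s" "s < x0" "eta s = s" by (rule fixpoint_between)
    note sg = phi_signs_below[OF s]
    consider "u < y0" | "y0 < u" "u \<le> s" | "s < u" "u < x0" | "x0 < u" using \<open>u \<noteq> x0\<close> \<open>u \<noteq> y0\<close> by linarith
    then show ?thesis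
    proof cases
      case 1
      then show ?thesis using env_increasing[of u y0] sg assms env_y0 by auto
    next
      case 2
      then show ?thesis using env_decreasing[of y0 u] sg assms env_y0 y0 by auto
    next
      case 3
      have "0 < phi v" if "u < v" "v < x0" for v
      proof (rule phi_mirror_pos)
        have *: "y0 < eta v" "eta v < s"
          using eta_strict_antimono[of v x0] eta_strict_antimono[of s v] eta_x0 s that 3 y0 by auto
        then show "phi (eta v) < 0" using sg by auto
        show "0 \<le> eta (eta v)" using eta_antimono[of "eta v" s] * s y0 by auto
      qed
      then show ?thesis using env_increasing[of u x0] 3 assms env_x0 by auto
    next
      case 4
      have "phi v < 0" if "x0 < v" "v < u" for v
      proof (rule phi_mirror_neg)
        show "0 < phi (eta v)"
          using eta_strict_antimono[of x0 v] eta_antimono[of v u] that x0 assms eta_x0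
          by (intro sg) auto
      qed (use that x0 in auto)
      then show ?thesis using env_decreasing[of x0 u] 4 x0 env_x0 by auto
    qed
  qed
  then show "env u \<le> lag x0 y0" "env u = lag x0 y0 \<Longrightarrow> u = x0 \<or> u = y0"
    using env_x0 env_y0 by (cases "u = x0 \<or> u = y0"; force)+
qed

text \<open>On the axis the maximizer is \<open>1 / k\<close>, by Young's inequality. There
  \<open>d < k ^ n\<close> makes \<open>eta\<close> positive, so moving off the axis to
  \<open>eta (1 / k)\<close> gains strictly.\<close>

lemma lag_axis_less:
  assumes "0 \<le> u"
  shows "lag u 0 < lag x0 y0"
proof -
  let ?u = "1 / k"
  have "eta ?u = (1 - d / k ^ n) / k" by (simp add: eta_def power_divide)
  then have eta: "0 < eta ?u" using d_less d k by (simp del: divide_divide_eq_left)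
  have "lag u 0 \<le> lag ?u 0"
  proof -
    have zn: "(0::real) ^ n = 0" using n by simp
    have "real (n + 1) * u ^ n * ?u \<le> real n * u ^ (n + 1) + ?u ^ (n + 1)"
      using assms k by (intro young_power) auto
    then have "kp * (real (n + 1) * u ^ n * ?u) \<le> kp * (real n * u ^ (n + 1) + ?u ^ (n + 1))"
      using kp by (intro mult_left_mono) auto
    moreover have "kp * (real (n + 1) * u ^ n * ?u) = (kp * real (n + 1)) * ?u * u ^ n" by simp
    moreover have "kp * real (n + 1) * ?u = 1" using k by (simp add: kp_def)
    ultimately have "1 * u ^ n \<le> kp * (real n * u ^ (n + 1) + ?u ^ (n + 1))" by (simp only:)
    then have "u ^ n - real n * kp * u ^ (n + 1) \<le> kp * ?u ^ (n + 1)"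
      by (simp only: algebra_simps mult_1)
    also have "\<dots> = (kp * real (n + 1)) * ?u * ?u ^ n - real n * kp * ?u ^ (n + 1)"
      by (simp add: algebra_simps)
    also have "kp * real (n + 1) * ?u = 1" using k by (simp add: kp_def)
    finally show ?thesis
      unfolding lag_def zn using n by simp
  qed
  also have "\<dots> < env ?u"
    using lag_le_env[of 0 ?u] eta by (cases "lag ?u 0 = env ?u") auto
  also have "\<dots> \<le> lag x0 y0" using env_le[of ?u] eta k by auto
  finally show ?thesis .
qed

text \<open>If \<open>eta u\<close> is negative, the coefficient \<open>1 - d * u ^ n\<close> of
  \<open>v ^ n\<close> is negative too, so \<open>v = 0\<close> is at least as good and the axis
  bound applies.\<close>

theorem lag_le:
  assumes "0 \<le> u" "0 \<le> v"
  shows "lag u v \<le> lag x0 y0"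
    and "lag u v = lag x0 y0 \<Longrightarrow> (u = x0 \<and> v = y0) \<or> (u = y0 \<and> v = x0)"
proof -
  have "lag u v \<le> lag x0 y0 \<and> (lag u v = lag x0 y0 \<longrightarrow> (u = x0 \<and> v = y0) \<or> (u = y0 \<and> v = x0))"
  proof (cases "0 \<le> eta u")
    case True
    show ?thesis
      using lag_le_env[OF \<open>0 \<le> v\<close> True] env_le[OF \<open>0 \<le> u\<close> True] eta_x0 eta_y0 by (smt (verit))
  next
    case False
    then have "1 - d * u ^ n < 0" using k_eta[of u] k by (simp add: mult_less_0_iff not_le flip: k_eta)
    then have "v ^ n * (1 - d * u ^ n) \<le> 0" using assms by (simp add: mult_nonneg_nonpos)
    moreover have "0 \<le> real n * kp * v ^ (n + 1)" using kp assms by simp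
    moreover have "lag u 0 - lag u v = real n * kp * v ^ (n + 1) - v ^ n * (1 - d * u ^ n)"
      using n by (simp add: lag_def algebra_simps)
    ultimately have "lag u v \<le> lag u 0"
      by linarith
    also have "\<dots> < lag x0 y0" using lag_axis_less assms by simp
    finally show ?thesis by simp
  qed
  then show "lag u v \<le> lag x0 y0"
    "lag u v = lag x0 y0 \<Longrightarrow> (u = x0 \<and> v = y0) \<or> (u = y0 \<and> v = x0)" by auto
qed

end

section \<open>From one spin to all spins\<close>

context crit_pair
begin

text \<open>The critical pair is normalized by its \<open>n\<close>-th powers, a phase by its powers
  of order \<open>n + 1\<close>; \<open>len Q\<close> is the scale converting the first
  normalization into the second.\<close>

definition len :: "real \<Rightarrow> real" where
  "len Q = root (n + 1) (2 / (Q * (x0 ^ (n + 1) + y0 ^ (n + 1))))"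

text \<open>Multiplying the critical equations by \<open>x0 ^ n\<close> and \<open>y0 ^ n\<close>
  and adding them expresses the mixed term through the powers of order \<open>n + 1\<close>, so the
  critical value of \<open>lag\<close> depends on these alone.\<close>

lemma crit_pair_norm:
  assumes "0 < Q" "Q * (x0 ^ n + y0 ^ n) = 2"
  shows len_pos: "0 < len Q"
    and len_power: "len Q ^ (n + 1) * (Q * (x0 ^ (n + 1) + y0 ^ (n + 1))) = 2"
    and lag_crit: "Q * lag x0 y0 = 1 - real (n - 1) * kp * (Q * (x0 ^ (n + 1) + y0 ^ (n + 1)) / 2)"
proof -
  let ?R = "Q * (x0 ^ (n + 1) + y0 ^ (n + 1))"
  have R: "0 < ?R" using assms x0 y0 by (intro mult_pos_pos add_pos_pos) auto
  show "0 < len Q" using R by (simp add: len_def del: power_Suc)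
  have "len Q ^ (n + 1) = 2 / ?R" unfolding len_def using R by (intro real_root_pow_pos2) auto
  then show "len Q ^ (n + 1) * ?R = 2" using R by (simp only: nonzero_eq_divide_eq[symmetric])
  have "k * x0 ^ (n + 1) = (k * x0) * x0 ^ n" "k * y0 ^ (n + 1) = (k * y0) * y0 ^ n"
    by simp_all
  then have kx: "k * x0 ^ (n + 1) = x0 ^ n - d * (x0 ^ n * y0 ^ n)"
    "k * y0 ^ (n + 1) = y0 ^ n - d * (x0 ^ n * y0 ^ n)"
    unfolding crit_x[symmetric] crit_y[symmetric] by (simp_all only: algebra_simps mult_1)
  have "k * ?R = Q * (k * x0 ^ (n + 1) + k * y0 ^ (n + 1))" by (simp add: algebra_simps)
  also have "\<dots> = Q * (x0 ^ n + y0 ^ n) - 2 * d * Q * (x0 ^ n * y0 ^ n)"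
    unfolding kx by (simp add: algebra_simps)
  finally have W: "k * ?R = 2 * (1 - d * Q * (x0 ^ n * y0 ^ n))" using assms by simp
  have "Q * lag x0 y0 = Q * (x0 ^ n + y0 ^ n) - d * Q * (x0 ^ n * y0 ^ n) - real n * kp * ?R"
    unfolding lag_def by (simp only: algebra_simps)
  also have "\<dots> = 1 + k * ?R / 2 - real n * kp * ?R" using W assms by simp
  also have "\<dots> = 1 - real (n - 1) * kp * (?R / 2)"
    using n by (subst k_kp) (simp add: of_nat_diff field_simps del: power_Suc)
  finally show "Q * lag x0 y0 = 1 - real (n - 1) * kp * (?R / 2)" .
qed

text \<open>With \<open>t = l / L\<close>, the form falls short of \<open>k * L ^ (n - 1)\<close> by
  three nonnegative amounts: the AM-GM square, the scaled total \<open>gap\<close> of the per-spin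
  deficits, and the Bernoulli deficit in \<open>t\<close>. In the equality case a vanishing
  \<open>gap\<close> produces \<open>T\<close>, and the vanishing square balances it.\<close>

theorem bilinear_form_le:
  fixes X Y :: "'q::finite \<Rightarrow> real"
  assumes Q: "real CARD('q) * (x0 ^ n + y0 ^ n) = 2"
    and nonneg: "\<And>i. 0 \<le> X i" "\<And>i. 0 \<le> Y i"
    and norm: "(\<Sum>i\<in>UNIV. X i ^ (n + 1)) = 1" "(\<Sum>i\<in>UNIV. Y i ^ (n + 1)) = 1"
  defines "L \<equiv> len (real CARD('q))"
  defines "F \<equiv> (\<Sum>i\<in>UNIV. X i ^ n) * (\<Sum>i\<in>UNIV. Y i ^ n) - d * (\<Sum>i\<in>UNIV. X i ^ n * Y i ^ n)"
  shows "F \<le> k * L ^ (n - 1)"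
    and "F = k * L ^ (n - 1) \<Longrightarrow> \<exists>T. (x0 = y0 \<or> 2 * card T = CARD('q)) \<and>
      (\<forall>i. X i = L * (if i \<in> T then x0 else y0)) \<and> (\<forall>i. Y i = L * (if i \<in> T then y0 else x0))"
proof -
  let ?Q = "real CARD('q)"
  let ?R = "?Q * (x0 ^ (n + 1) + y0 ^ (n + 1))"
  let ?SX = "\<Sum>i\<in>UNIV. X i ^ n" and ?SY = "\<Sum>i\<in>UNIV. Y i ^ n"
  have Qpos: "0 < ?Q" by simp
  note cn = crit_pair_norm[OF Qpos Q, folded L_def]
  define l where "l = root n ((?SX + ?SY) / 2)"
  have SX: "0 < ?SX"
  proof -
    have "\<exists>i. X i \<noteq> 0"
    proof (rule ccontr)
      assume "\<not> ?thesis"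
      then show False using norm(1) by simp
    qed
    then obtain i where "0 < X i ^ n" using nonneg by (metis less_le zero_less_power)
    then show ?thesis using nonneg by (intro sum_pos2[of _ i]) auto
  qed
  have SY: "0 \<le> ?SY" using nonneg by (intro sum_nonneg) auto
  have l: "0 < l" "l ^ n = (?SX + ?SY) / 2"
    unfolding l_def using n SX SY by (auto intro!: real_root_pow_pos2)
  define x where "x i = X i / l" for i
  define y where "y i = Y i / l" for i
  have xy: "0 \<le> x i" "0 \<le> y i" "X i = l * x i" "Y i = l * y i" for i
    using l nonneg by (auto simp: x_def y_def)
  have sum_n: "(\<Sum>i\<in>UNIV. x i ^ n) + (\<Sum>i\<in>UNIV. y i ^ n) = 2"
  proof -
    have "l ^ n * ((\<Sum>i\<in>UNIV. x i ^ n) + (\<Sum>i\<in>UNIV. y i ^ n)) = ?SX + ?SY"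
      by (simp add: xy power_mult_distrib sum_distrib_left distrib_left)
    also have "\<dots> = l ^ n * 2" using l by simp
    finally show ?thesis using l by (simp only: mult_cancel_left) auto
  qed
  have sum_Suc: "l ^ (n + 1) * ((\<Sum>i\<in>UNIV. x i ^ (n + 1)) + (\<Sum>i\<in>UNIV. y i ^ (n + 1))) = 2"
    using norm unfolding xy power_mult_distrib distrib_left sum_distrib_left by simp
  have slack: "0 \<le> lag x0 y0 - lag (x i) (y i)" for i using lag_le(1)[OF xy(1,2)] by simp
  define gap where "gap = (\<Sum>i\<in>UNIV. lag x0 y0 - lag (x i) (y i))"
  have gap: "0 \<le> gap" unfolding gap_def using slack by (intro sum_nonneg) auto
  let ?C = "\<Sum>i\<in>UNIV. x i ^ n * y i ^ n"
  let ?P = "(\<Sum>i\<in>UNIV. x i ^ (n + 1)) + (\<Sum>i\<in>UNIV. y i ^ (n + 1))"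
  have "(\<Sum>i\<in>UNIV. lag (x i) (y i)) = 2 - d * ?C - real n * kp * ?P"
    unfolding lag_def sum_n[symmetric]
    by (simp add: sum.distrib sum_subtractf sum_distrib_left algebra_simps del: power_Suc)
  then have C: "1 - d * ?C = real n * kp * ?P - real (n - 1) * kp * (?R / 2) - gap"
    using cn(3) unfolding gap_def by (simp add: sum_subtractf del: power_Suc)
  have F_eq: "F = l ^ (2 * n) * (1 - d * ?C) - ((?SX - ?SY) / 2)\<^sup>2"
  proof -
    have "(\<Sum>i\<in>UNIV. X i ^ n * Y i ^ n) = l ^ (2 * n) * ?C"
      unfolding mult_2 power_add sum_distrib_left xy power_mult_distrib
      by (intro sum.cong) (simp_all only: mult_ac)
    moreover have "?SX * ?SY = (l ^ n)\<^sup>2 - ((?SX - ?SY) / 2)\<^sup>2"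
      unfolding l by (simp add: power2_eq_square field_simps)
    moreover have "(l ^ n)\<^sup>2 = l ^ (2 * n)" by (simp add: mult.commute flip: power_mult)
    ultimately show ?thesis unfolding F_def by (simp add: algebra_simps)
  qed
  define t where "t = l / L"
  have t: "0 \<le> t" "l = L * t" using l cn(1) by (auto simp: t_def)
  have main: "l ^ (2 * n) * (1 - d * ?C) = kp * L ^ (n - 1) * (2 * real n * t ^ (n - 1) - real (n - 1) * t ^ (2 * n))
      - l ^ (2 * n) * gap"
  proof -
    have split: "2 * n = (n - 1) + (n + 1)" using n by simp
    have "l ^ (2 * n) * ?P = 2 * l ^ (n - 1)"
      using sum_Suc unfolding split power_add[of _ "n - 1" "n + 1"] by (simp only: mult_ac)
    moreover have "l ^ (2 * n) * ?R = 2 * L ^ (n - 1) * t ^ (2 * n)"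
    proof -
      have "L ^ (2 * n) * ?R = 2 * L ^ (n - 1)"
        using arg_cong[OF cn(2), of "(*) (L ^ (n - 1))"]
        unfolding split power_add[of _ "n - 1" "n + 1"] by (simp only: mult.assoc mult.commute[of 2])
      then have "L ^ (2 * n) * ?R * t ^ (2 * n) = 2 * L ^ (n - 1) * t ^ (2 * n)" by (simp only:)
      then show ?thesis unfolding t(2) power_mult_distrib by (simp only: mult_ac)
    qed
    moreover have "l ^ (n - 1) = L ^ (n - 1) * t ^ (n - 1)" unfolding t(2) by (rule power_mult_distrib)
    moreover have "l ^ (2 * n) * (1 - d * ?C) = real n * kp * (l ^ (2 * n) * ?P)
        - real (n - 1) * kp * (l ^ (2 * n) * ?R / 2) - l ^ (2 * n) * gap"
      unfolding C by (simp add: algebra_simps del: power_Suc)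
    ultimately show ?thesis by (simp add: algebra_simps)
  qed
  have B: "kp * L ^ (n - 1) * (2 * real n * t ^ (n - 1) - real (n - 1) * t ^ (2 * n)) \<le> k * L ^ (n - 1)"
  proof -
    have "2 * real n * t ^ (n - 1) - real (n - 1) * t ^ (2 * n) \<le> real (n + 1)"
    proof -
      have "n - 1 \<le> 2 * n" "2 * n - (n - 1) = n + 1" using n by auto
      then show ?thesis using bernoulli_interpolation[OF t(1), of "n - 1" "2 * n"] by simp
    qed
    then have "kp * L ^ (n - 1) * (2 * real n * t ^ (n - 1) - real (n - 1) * t ^ (2 * n)) \<le> kp * L ^ (n - 1) * real (n + 1)"
      using kp cn(1) by (intro mult_left_mono) auto
    also have "\<dots> = (real n * kp + kp) * L ^ (n - 1)" by (simp add: algebra_simps)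
    also have "\<dots> = k * L ^ (n - 1)" using k_kp by simp
    finally show ?thesis .
  qed
  have lg: "0 \<le> l ^ (2 * n) * gap" using l gap by simp
  show "F \<le> k * L ^ (n - 1)" using F_eq main B lg by (smt (verit) zero_le_power2)
  assume eq: "F = k * L ^ (n - 1)"
  have "l ^ (2 * n) * gap = 0" and sq: "((?SX - ?SY) / 2)\<^sup>2 = 0"
    using F_eq main B lg eq zero_le_power2[of "(?SX - ?SY) / 2"] by linarith+
  then have "gap = 0" and S_eq: "?SX = ?SY" using l by auto
  then have "lag (x i) (y i) = lag x0 y0" for i
    using slack unfolding gap_def by (subst (asm) sum_nonneg_eq_0_iff) auto
  then have argmax: "(x i = x0 \<and> y i = y0) \<or> (x i = y0 \<and> y i = x0)" for i
    using lag_le(2) xy by blast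
  define T where "T = {i. x i = x0 \<and> y i = y0}"
  have T: "x i = (if i \<in> T then x0 else y0)" "y i = (if i \<in> T then y0 else x0)" for i
    using argmax[of i] by (auto simp: T_def)
  \<comment> \<open>Once every spin sits at the critical pair or its mirror image, the normalization
    of the powers of order \<open>n + 1\<close> fixes the scale.\<close>
  have lL: "l = L"
  proof -
    have "?P = (\<Sum>i\<in>(UNIV::'q set). x0 ^ (n + 1) + y0 ^ (n + 1))"
      unfolding sum.distrib[symmetric] T by (intro sum.cong) auto
    also have "\<dots> = ?R" by simp
    finally have "l ^ (n + 1) * ?R = 2" using sum_Suc by simp
    then have "l ^ (n + 1) * ?R = L ^ (n + 1) * ?R" using cn(2) by simp
    moreover have "?R \<noteq> 0" using cn(2) by force
    ultimately have "l ^ (n + 1) = L ^ (n + 1)" by simp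
    then show ?thesis using l cn(1) by (simp add: power_eq_iff_eq_base del: power_Suc)
  qed
  have "x0 = y0 \<or> 2 * card T = CARD('q)"
  proof (rule disjCI)
    assume "2 * card T \<noteq> CARD('q)"
    have split: "(\<Sum>i\<in>UNIV. if i \<in> T then a else b) = real (card T) * a + (?Q - real (card T)) * b" for a b :: real
    proof -
      have "(\<Sum>i\<in>UNIV. if i \<in> T then a else b) = (\<Sum>i\<in>UNIV. b + (if i \<in> T then a - b else 0))"
        by (intro sum.cong) auto
      also have "\<dots> = ?Q * b + real (card T) * (a - b)" by (simp add: sum.distrib flip: sum.inter_filter)
      finally show ?thesis by (simp add: algebra_simps)
    qed
    have if_pow: "(if P then a else b) ^ n = (if P then a ^ n else b ^ n)" for P and a b :: real by simp
    have "(\<Sum>i\<in>UNIV. x i ^ n) = (\<Sum>i\<in>UNIV. y i ^ n)"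
      using S_eq l(1) unfolding xy power_mult_distrib sum_distrib_left[symmetric] by simp
    then have "(2 * real (card T) - ?Q) * (x0 ^ n - y0 ^ n) = 0"
      unfolding T if_pow split by (simp add: algebra_simps)
    moreover have "2 * real (card T) - ?Q \<noteq> 0" using \<open>2 * card T \<noteq> CARD('q)\<close> by linarith
    ultimately have "x0 ^ n = y0 ^ n" by simp
    then show "x0 = y0" using n x0 y0 by (simp add: power_eq_iff_eq_base)
  qed
  then show "\<exists>T. (x0 = y0 \<or> 2 * card T = CARD('q)) \<and>
      (\<forall>i. X i = L * (if i \<in> T then x0 else y0)) \<and> (\<forall>i. Y i = L * (if i \<in> T then y0 else x0))"
    using T xy lL by metis
qed

end

subsection \<open>The Gibbs bound\<close>

lemma potts_int_sum:
  fixes b :: "'q::finite \<Rightarrow> real"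
  shows "(\<Sum>j\<in>UNIV. potts_int B i j * b j) = (\<Sum>j\<in>UNIV. b j) - (1 - B) * b i"
proof -
  have "(\<Sum>j\<in>UNIV. potts_int B i j * b j) = (\<Sum>j\<in>UNIV. b j - (if j = i then (1 - B) * b i else 0))"
    by (intro sum.cong) (auto simp: potts_int_def algebra_simps)
  then show ?thesis by (simp add: sum_subtractf)
qed

lemma potts_int_commute: "potts_int B i j = potts_int B j i"
  by (simp add: potts_int_def)

lemma potts_int_nonneg: "0 \<le> B \<Longrightarrow> 0 \<le> potts_int B i j"
  by (simp add: potts_int_def)

lemma plogp_power: "0 \<le> t \<Longrightarrow> plogp (t ^ Suc n) = real (Suc n) * t ^ Suc n * ln t"
  by (cases "t = 0") (simp_all add: plogp_def ln_realpow del: power_Suc)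

lemma admissibleD:
  assumes "admissible B p x"
  shows "0 \<le> x $ i $ j" "(\<Sum>j\<in>UNIV. x $ i $ j) = fst p $ i" "(\<Sum>i\<in>UNIV. x $ i $ j) = snd p $ j"
    "potts_int B i j = 0 \<Longrightarrow> x $ i $ j = 0"
  using assms unfolding admissible_def by blast+

lemma admissible_total:
  assumes "admissible B p x" "p \<in> prob_simplex \<times> prob_simplex"
  shows "(\<Sum>i\<in>UNIV. \<Sum>j\<in>UNIV. x $ i $ j) = 1"
  using assms by (auto simp: admissible_def prob_simplex_def)

lemma admissible_sum_weights:
  assumes "admissible B p x"
  shows "(\<Sum>i\<in>UNIV. \<Sum>j\<in>UNIV. x $ i $ j * (f i + g j)) = (\<Sum>i\<in>UNIV. fst p $ i * f i) + (\<Sum>j\<in>UNIV. snd p $ j * g j)"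
proof -
  have "(\<Sum>i\<in>UNIV. \<Sum>j\<in>UNIV. x $ i $ j * (f i + g j))
      = (\<Sum>i\<in>UNIV. (\<Sum>j\<in>UNIV. x $ i $ j) * f i) + (\<Sum>i\<in>UNIV. \<Sum>j\<in>UNIV. x $ i $ j * g j)"
    by (simp add: distrib_left sum.distrib sum_distrib_right)
  also have "(\<Sum>i\<in>UNIV. \<Sum>j\<in>UNIV. x $ i $ j * g j) = (\<Sum>j\<in>UNIV. (\<Sum>i\<in>UNIV. x $ i $ j) * g j)"
    by (subst sum.swap) (simp add: sum_distrib_right)
  finally show ?thesis using assms by (simp add: admissible_def)
qed

text \<open>Gibbs' inequality; the slack is the relative entropy of x with respect to the edge weights B r c.\<close>
lemma psi_obj_le:
  assumes "0 \<le> B" and adm: "admissible B p x"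
    and nonneg: "\<And>i. 0 \<le> r i" "\<And>j. 0 \<le> c j"
    and supp: "\<And>i j. 0 < x $ i $ j \<Longrightarrow> 0 < r i \<and> 0 < c j"
  shows "psi_obj \<Delta> B p x \<le> (real \<Delta> - 1) * ((\<Sum>i\<in>UNIV. plogp (fst p $ i)) + (\<Sum>j\<in>UNIV. plogp (snd p $ j)))
     + real \<Delta> * ((\<Sum>i\<in>UNIV. \<Sum>j\<in>UNIV. potts_int B i j * r i * c j) - (\<Sum>i\<in>UNIV. \<Sum>j\<in>UNIV. x $ i $ j)
       - (\<Sum>i\<in>UNIV. fst p $ i * ln (r i)) - (\<Sum>j\<in>UNIV. snd p $ j * ln (c j)))"
proof -
  have "(if x $ i $ j = 0 then 0 else x $ i $ j * ln (potts_int B i j) - plogp (x $ i $ j))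
      \<le> potts_int B i j * r i * c j - x $ i $ j - x $ i $ j * (ln (r i) + ln (c j))" for i j
  proof (cases "x $ i $ j = 0")
    case True
    moreover have "0 \<le> potts_int B i j * r i * c j"
      by (intro mult_nonneg_nonneg nonneg potts_int_nonneg \<open>0 \<le> B\<close>)
    ultimately show ?thesis by simp
  next
    case False
    let ?x = "x $ i $ j" and ?b = "potts_int B i j"
    have pos: "0 < ?x" "0 < ?b"
      using False admissibleD(1,4)[OF adm, of i j] potts_int_nonneg[OF \<open>0 \<le> B\<close>, of i j] by argo+
    note rc = supp[OF pos(1)]
    have "?x * ln (?b * r i * c j / ?x) \<le> ?x * (?b * r i * c j / ?x - 1)"
      using pos rc by (intro mult_left_mono ln_le_minus_one) auto
    also have "ln (?b * r i * c j / ?x) = ln ?b + ln (r i) + ln (c j) - ln ?x"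
      using pos rc by (simp add: ln_div ln_mult)
    finally show ?thesis using pos False by (simp add: plogp_def algebra_simps)
  qed
  then have "(\<Sum>i\<in>UNIV. \<Sum>j\<in>UNIV. (if x $ i $ j = 0 then 0 else x $ i $ j * ln (potts_int B i j) - plogp (x $ i $ j)))
     \<le> (\<Sum>i\<in>UNIV. \<Sum>j\<in>UNIV. potts_int B i j * r i * c j - x $ i $ j - x $ i $ j * (ln (r i) + ln (c j)))"
    by (intro sum_mono)
  also have "\<dots> = (\<Sum>i\<in>UNIV. \<Sum>j\<in>UNIV. potts_int B i j * r i * c j) - (\<Sum>i\<in>UNIV. \<Sum>j\<in>UNIV. x $ i $ j)
       - (\<Sum>i\<in>UNIV. fst p $ i * ln (r i)) - (\<Sum>j\<in>UNIV. snd p $ j * ln (c j))"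
    using admissible_sum_weights[OF adm] by (simp add: sum_subtractf)
  finally show ?thesis unfolding psi_obj_def by (intro add_left_mono mult_left_mono) auto
qed

text \<open>The scaled matrix with entries \<open>potts_int B i j * r i * c j\<close> is itself
  admissible and makes Gibbs' inequality, used with the same \<open>r\<close> and \<open>c\<close>,
  an equality.\<close>

lemma Psi1_scaled:
  fixes p :: "'q::finite phase"
  assumes "0 \<le> B" and pos: "\<And>i. 0 < r i" "\<And>j. 0 < c j"
    and marg: "\<And>i. (\<Sum>j\<in>UNIV. potts_int B i j * r i * c j) = fst p $ i"
      "\<And>j. (\<Sum>i\<in>UNIV. potts_int B i j * r i * c j) = snd p $ j"
  shows "Psi1 \<Delta> B p = ereal ((real \<Delta> - 1) * ((\<Sum>i\<in>UNIV. plogp (fst p $ i)) + (\<Sum>j\<in>UNIV. plogp (snd p $ j)))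
     - real \<Delta> * ((\<Sum>i\<in>UNIV. fst p $ i * ln (r i)) + (\<Sum>j\<in>UNIV. snd p $ j * ln (c j))))" (is "_ = ereal ?v")
proof -
  define x :: "real ^ 'q ^ 'q" where "x = (\<chi> i j. potts_int B i j * r i * c j)"
  have adm: "admissible B p x"
    using marg by (auto simp: admissible_def x_def intro!: mult_nonneg_nonneg less_imp_le[OF pos(1)]
      less_imp_le[OF pos(2)] potts_int_nonneg[OF \<open>0 \<le> B\<close>])
  have "(if x $ i $ j = 0 then 0 else x $ i $ j * ln (potts_int B i j) - plogp (x $ i $ j))
      = - (x $ i $ j * (ln (r i) + ln (c j)))" for i j
  proof (cases "potts_int B i j = 0")
    case False
    then show ?thesis
      using pos[THEN less_imp_neq] pos potts_int_nonneg[OF \<open>0 \<le> B\<close>, of i j]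
      by (simp add: x_def plogp_def ln_mult algebra_simps)
  qed (simp add: x_def)
  then have obj: "psi_obj \<Delta> B p x = ?v"
    unfolding psi_obj_def using admissible_sum_weights[OF adm, of "\<lambda>i. ln (r i)" "\<lambda>j. ln (c j)"]
    by (simp add: sum_negf) (simp add: algebra_simps)
  have total: "(\<Sum>i\<in>UNIV. \<Sum>j\<in>UNIV. y $ i $ j) = (\<Sum>i\<in>UNIV. fst p $ i)" if "admissible B p y" for y
    using admissibleD(2)[OF that] by simp
  have "psi_obj \<Delta> B p y \<le> ?v" if y: "admissible B p y" for y
    using psi_obj_le[OF \<open>0 \<le> B\<close> y, of r c \<Delta>, OF less_imp_le[OF pos(1)] less_imp_le[OF pos(2)] conjI[OF pos]]
    unfolding total[OF y] marg(1) by (simp add: algebra_simps)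
  then show ?thesis
    unfolding Psi1_def obj[symmetric] using adm
    by (intro antisym SUP_least SUP_upper) auto
qed

context
  fixes p :: "'q::finite phase" and B :: real and n :: nat and X Y :: "'q \<Rightarrow> real"
  assumes B: "0 \<le> B" and n: "0 < n"
    and X: "\<And>i. 0 \<le> X i" "\<And>i. fst p $ i = X i ^ Suc n"
    and Y: "\<And>i. 0 \<le> Y i" "\<And>i. snd p $ i = Y i ^ Suc n"
    and p: "p \<in> prob_simplex \<times> prob_simplex"
begin

lemma plogp_sums:
  "(\<Sum>i\<in>UNIV. plogp (fst p $ i)) = real (Suc n) * (\<Sum>i\<in>UNIV. fst p $ i * ln (X i))"
  "(\<Sum>i\<in>UNIV. plogp (snd p $ i)) = real (Suc n) * (\<Sum>i\<in>UNIV. snd p $ i * ln (Y i))"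
  using X Y by (simp_all add: plogp_power sum_distrib_left mult.assoc del: power_Suc)

text \<open>Gibbs' inequality with \<open>r i = X i ^ n / F\<close> and
  \<open>c j = Y j ^ n\<close>: the weights then have total 1, and their logarithms cancel the
  entropy terms because \<open>plogp\<close> of a power contributes the factor \<open>Suc n\<close>.
  Only \<open>ln F\<close> is left.\<close>

lemma psi_obj_le_ln:
  assumes adm: "admissible B p x"
  defines "F \<equiv> \<Sum>i\<in>UNIV. \<Sum>j\<in>UNIV. potts_int B i j * X i ^ n * Y j ^ n"
  shows "0 < F" and "psi_obj (Suc n) B p x \<le> real (Suc n) * ln F"
proof -
  have supp: "0 < X i ^ n \<and> 0 < Y j ^ n" if "0 < x $ i $ j" for i j
  proof -
    note nn = admissibleD(1)[OF adm]
    have "x $ i $ j \<le> fst p $ i" "x $ i $ j \<le> snd p $ j"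
      unfolding admissibleD(2,3)[OF adm, symmetric] using nn by (auto intro: member_le_sum)
    then have "X i \<noteq> 0" "Y j \<noteq> 0" using that X Y by auto
    then have "0 < X i" "0 < Y j" using X(1)[of i] Y(1)[of j] by argo+
    then show ?thesis by simp
  qed
  have nnF: "0 \<le> potts_int B i j * X i ^ n * Y j ^ n" for i j
    by (intro mult_nonneg_nonneg zero_le_power X(1) Y(1) potts_int_nonneg B)
  have total: "(\<Sum>i\<in>UNIV. \<Sum>j\<in>UNIV. x $ i $ j) = 1" using admissible_total[OF adm p] .
  then obtain i where i: "(\<Sum>j\<in>UNIV. x $ i $ j) \<noteq> 0"
    by (metis (mono_tags, lifting) sum.neutral zero_neq_one)
  then obtain j where "x $ i $ j \<noteq> 0" by (metis (mono_tags, lifting) sum.neutral)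
  then have xij: "0 < x $ i $ j" "0 < potts_int B i j"
    using admissibleD(1,4)[OF adm, of i j] potts_int_nonneg[OF B, of i j] by argo+
  then have "0 < potts_int B i j * X i ^ n * Y j ^ n"
    using supp[OF xij(1)] by simp
  then have "0 < (\<Sum>j\<in>UNIV. potts_int B i j * X i ^ n * Y j ^ n)"
    using nnF by (intro sum_pos2[of _ j]) auto
  then show F: "0 < F"
    unfolding F_def using nnF by - (rule sum_pos2[of _ i], auto intro!: sum_nonneg)
  have lnX: "fst p $ i * ln (X i ^ n / F) = real n * (fst p $ i * ln (X i)) - fst p $ i * ln F" for i
    using X(2)[of i] X(1)[of i] F by (cases "X i = 0") (simp_all add: ln_div ln_realpow algebra_simps)
  have lnY: "snd p $ i * ln (Y i ^ n) = real n * (snd p $ i * ln (Y i))" for i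
    using Y(2)[of i] Y(1)[of i] by (cases "Y i = 0") (simp_all add: ln_realpow algebra_simps)
  have sum1: "(\<Sum>i\<in>UNIV. fst p $ i) = 1" using p by (auto simp: prob_simplex_def)
  have FF: "(\<Sum>i\<in>UNIV. \<Sum>j\<in>UNIV. potts_int B i j * (X i ^ n / F) * Y j ^ n) = 1"
    using F unfolding F_def by (simp flip: sum_divide_distrib)
  have "psi_obj (Suc n) B p x \<le> (real (Suc n) - 1) * ((\<Sum>i\<in>UNIV. plogp (fst p $ i)) + (\<Sum>j\<in>UNIV. plogp (snd p $ j)))
     + real (Suc n) * (1 - 1 - (\<Sum>i\<in>UNIV. fst p $ i * ln (X i ^ n / F)) - (\<Sum>j\<in>UNIV. snd p $ j * ln (Y j ^ n)))"
    using psi_obj_le[OF B adm, of "\<lambda>i. X i ^ n / F" "\<lambda>j. Y j ^ n" "Suc n"] supp F X(1) Y(1)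
    unfolding FF total by simp
  also have "\<dots> = real (Suc n) * ln F"
    unfolding plogp_sums lnX lnY sum_subtractf sum_distrib_left[symmetric] sum_distrib_right[symmetric] sum1
    by (simp add: algebra_simps)
  finally show "psi_obj (Suc n) B p x \<le> real (Suc n) * ln F" .
qed

lemma Psi1_le_ln:
  assumes "(\<Sum>i\<in>UNIV. \<Sum>j\<in>UNIV. potts_int B i j * X i ^ n * Y j ^ n) \<le> M"
  shows "Psi1 (Suc n) B p \<le> ereal (real (Suc n) * ln M)"
  unfolding Psi1_def
proof (rule SUP_least)
  fix x assume "x \<in> {x. admissible B p x}"
  then have adm: "admissible B p x" by simp
  have "psi_obj (Suc n) B p x \<le> real (Suc n) * ln (\<Sum>i\<in>UNIV. \<Sum>j\<in>UNIV. potts_int B i j * X i ^ n * Y j ^ n)"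
    by (rule psi_obj_le_ln[OF adm])
  also have "\<dots> \<le> real (Suc n) * ln M"
    using psi_obj_le_ln(1)[OF adm] assms by (intro mult_left_mono) auto
  finally show "ereal (psi_obj (Suc n) B p x) \<le> ereal (real (Suc n) * ln M)" by simp
qed

lemma Psi1_ge_ln_imp:
  assumes "0 < M" "ereal (real (Suc n) * ln M) \<le> Psi1 (Suc n) B p"
  shows "M \<le> (\<Sum>i\<in>UNIV. \<Sum>j\<in>UNIV. potts_int B i j * X i ^ n * Y j ^ n)" (is "M \<le> ?F")
proof (rule ccontr)
  assume "\<not> M \<le> ?F"
  \<comment> \<open>The sum \<open>?F\<close> may be \<open>0\<close>, where its logarithm is of no
    use; \<open>M'\<close> is positive and still below \<open>M\<close>.\<close>
  define M' where "M' = max ?F (M / 2)"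
  have M': "?F \<le> M'" "0 < M'" "M' < M" using \<open>\<not> M \<le> ?F\<close> \<open>0 < M\<close> by (auto simp: M'_def)
  have "ereal (real (Suc n) * ln M) \<le> ereal (real (Suc n) * ln M')"
    using assms(2) Psi1_le_ln[OF M'(1)] by (rule order_trans)
  then have "real (Suc n) * ln M \<le> real (Suc n) * ln M'" by (simp only: ereal_less_eq)
  then have "ln M \<le> ln M'" by (rule mult_left_le_imp_le) simp
  then show False using M' \<open>0 < M\<close> by simp
qed

lemma Psi1_critical:
  assumes "0 < M" "\<And>i. 0 < X i" "\<And>i. 0 < Y i"
    and marg: "\<And>i. (\<Sum>j\<in>UNIV. potts_int B i j * X i ^ n * Y j ^ n) = M * fst p $ i"
      "\<And>j. (\<Sum>i\<in>UNIV. potts_int B i j * X i ^ n * Y j ^ n) = M * snd p $ j"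
  shows "Psi1 (Suc n) B p = ereal (real (Suc n) * ln M)"
proof -
  have lnX: "fst p $ i * ln (X i ^ n / M) = real n * (fst p $ i * ln (X i)) - fst p $ i * ln M" for i
    using assms(1) assms(2)[of i] by (simp add: ln_div ln_realpow algebra_simps)
  have lnY: "snd p $ i * ln (Y i ^ n) = real n * (snd p $ i * ln (Y i))" for i
    using assms(3)[of i] by (simp add: ln_realpow algebra_simps)
  have sum1: "(\<Sum>i\<in>UNIV. fst p $ i) = 1" using p by (auto simp: prob_simplex_def)
  have "Psi1 (Suc n) B p = ereal ((real (Suc n) - 1) * ((\<Sum>i\<in>UNIV. plogp (fst p $ i)) + (\<Sum>j\<in>UNIV. plogp (snd p $ j)))
     - real (Suc n) * ((\<Sum>i\<in>UNIV. fst p $ i * ln (X i ^ n / M)) + (\<Sum>j\<in>UNIV. snd p $ j * ln (Y j ^ n))))"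
    using assms marg by (intro Psi1_scaled[OF B]) (auto simp flip: sum_divide_distrib)
  also have "\<dots> = ereal (real (Suc n) * ln M)"
    unfolding plogp_sums lnX lnY sum_subtractf sum_distrib_left[symmetric] sum_distrib_right[symmetric] sum1
    by (simp add: algebra_simps)
  finally show ?thesis .
qed

end

subsection \<open>Differentiability of the dual problem\<close>

lemma has_derivative_vec_lambda:
  fixes f :: "'n::finite \<Rightarrow> 'a::real_normed_vector \<Rightarrow> real"
  assumes "\<And>i. (f i has_derivative f' i) (at x within S)"
  shows "((\<lambda>x. \<chi> i. f i x) has_derivative (\<lambda>h. \<chi> i. f' i h)) (at x within S)"
  using assms by (subst has_derivative_componentwise_within) (auto simp: Basis_vec_def inner_axis)

lemma bounded_linear_fst_nth: "bounded_linear (\<lambda>z :: 'q::finite phase. fst z $ i)"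
  by (rule bounded_linear_compose[OF bounded_linear_vec_nth bounded_linear_fst])

lemma bounded_linear_snd_nth: "bounded_linear (\<lambda>z :: 'q::finite phase. snd z $ i)"
  by (rule bounded_linear_compose[OF bounded_linear_vec_nth bounded_linear_snd])

lemmas has_derivative_phase_nth [derivative_intros] =
  bounded_linear.has_derivative[OF bounded_linear_fst_nth]
  bounded_linear.has_derivative[OF bounded_linear_snd_nth]

lemmas continuous_on_phase_nth [continuous_intros] =
  bounded_linear.continuous_on[OF bounded_linear_fst_nth]
  bounded_linear.continuous_on[OF bounded_linear_snd_nth]

lemma inner_phase:
  fixes u w :: "'q::finite phase"
  shows "inner u w = (\<Sum>i\<in>UNIV. fst u $ i * fst w $ i) + (\<Sum>j\<in>UNIV. snd u $ j * snd w $ j)"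
  by (simp add: inner_prod_def inner_vec_def)

section \<open>The dual potential and its gradient map\<close>

definition edge_wt :: "real \<Rightarrow> ('q::finite) phase \<Rightarrow> 'q \<Rightarrow> 'q \<Rightarrow> real" where
  "edge_wt B z i j = potts_int B i j * exp (fst z $ i + snd z $ j)"

text \<open>The pairing with \<open>(1, - 1)\<close>, the direction along which all edge weights are
  constant.\<close>

definition mass_gap :: "('q::finite) phase \<Rightarrow> real" where
  "mass_gap z = (\<Sum>i\<in>UNIV. fst z $ i) - (\<Sum>j\<in>UNIV. snd z $ j)"

text \<open>The convex dual potential of the maximization over x.  The quadratic term removes the degeneracy
  of the exponential sum along the direction (1, -1); it vanishes wherever the gradient has both
  marginals of equal mass, so it does not disturb the values on \<open>sum_one_plane\<close>.\<close>
definition potential :: "real \<Rightarrow> real \<Rightarrow> ('q::finite) phase \<Rightarrow> real" where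
  "potential B c0 z = (\<Sum>i\<in>UNIV. \<Sum>j\<in>UNIV. edge_wt B z i j) + (mass_gap z - c0)\<^sup>2 / 2"

definition grad_pot :: "real \<Rightarrow> real \<Rightarrow> ('q::finite) phase \<Rightarrow> 'q phase" where
  "grad_pot B c0 z = ((\<chi> i. (\<Sum>j\<in>UNIV. edge_wt B z i j) + (mass_gap z - c0)),
                      (\<chi> j. (\<Sum>i\<in>UNIV. edge_wt B z i j) - (mass_gap z - c0)))"

definition hess_pot :: "real \<Rightarrow> ('q::finite) phase \<Rightarrow> 'q phase \<Rightarrow> 'q phase" where
  "hess_pot B z w = ((\<chi> i. (\<Sum>j\<in>UNIV. edge_wt B z i j * (fst w $ i + snd w $ j)) + mass_gap w),
                     (\<chi> j. (\<Sum>i\<in>UNIV. edge_wt B z i j * (fst w $ i + snd w $ j)) - mass_gap w))"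

lemma has_derivative_edge_wt [derivative_intros]:
  "((\<lambda>z. edge_wt B z i j) has_derivative (\<lambda>w. edge_wt B z i j * (fst w $ i + snd w $ j))) (at z within S)"
  unfolding edge_wt_def [abs_def] by (auto intro!: derivative_eq_intros simp: algebra_simps)

lemma has_derivative_mass_gap [derivative_intros]: "(mass_gap has_derivative mass_gap) (at z within S)"
  unfolding mass_gap_def [abs_def] by (auto intro!: derivative_eq_intros)

lemma has_derivative_grad_pot: "(grad_pot B c0 has_derivative hess_pot B z) (at z within S)"
  unfolding grad_pot_def [abs_def] hess_pot_def [abs_def]
  by (intro has_derivative_Pair has_derivative_vec_lambda) (auto intro!: derivative_eq_intros)

lemma inner_fst_snd_sums:
  fixes u :: "'q::finite phase" and t :: "'q \<Rightarrow> 'q \<Rightarrow> real"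
  shows "inner u ((\<chi> i. (\<Sum>j\<in>UNIV. t i j) + a), (\<chi> j. (\<Sum>i\<in>UNIV. t i j) - a))
    = (\<Sum>i\<in>UNIV. \<Sum>j\<in>UNIV. t i j * (fst u $ i + snd u $ j)) + a * mass_gap u"
proof -
  have "(\<Sum>j\<in>UNIV. snd u $ j * (\<Sum>i\<in>UNIV. t i j)) = (\<Sum>i\<in>UNIV. \<Sum>j\<in>UNIV. t i j * snd u $ j)"
    by (subst sum.swap) (simp add: sum_distrib_left mult.commute)
  moreover have "(\<Sum>i\<in>UNIV. fst u $ i * (\<Sum>j\<in>UNIV. t i j)) = (\<Sum>i\<in>UNIV. \<Sum>j\<in>UNIV. t i j * fst u $ i)"
    by (simp add: sum_distrib_left mult.commute)
  ultimately show ?thesis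
    by (simp add: inner_phase mass_gap_def distrib_left right_diff_distrib sum.distrib sum_subtractf
        sum_distrib_left mult.commute)
qed

lemma inner_hess_pot:
  "inner u (hess_pot B z w) = (\<Sum>i\<in>UNIV. \<Sum>j\<in>UNIV. edge_wt B z i j * (fst w $ i + snd w $ j) * (fst u $ i + snd u $ j))
     + mass_gap w * mass_gap u"
  unfolding hess_pot_def by (rule inner_fst_snd_sums)

lemma inner_grad_pot:
  "inner u (grad_pot B c0 z) = (\<Sum>i\<in>UNIV. \<Sum>j\<in>UNIV. edge_wt B z i j * (fst u $ i + snd u $ j))
     + (mass_gap z - c0) * mass_gap u"
  unfolding grad_pot_def by (rule inner_fst_snd_sums)

lemma has_derivative_potential:
  "(potential B c0 has_derivative (\<lambda>w. inner w (grad_pot B c0 z))) (at z within S)"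
  unfolding inner_grad_pot potential_def [abs_def]
  by (auto intro!: derivative_eq_intros simp: field_simps)

lemma edge_wt_nonneg: "0 \<le> B \<Longrightarrow> 0 \<le> edge_wt B z i j"
  by (simp add: edge_wt_def potts_int_nonneg)

lemma edge_wt_off_diag: "i \<noteq> j \<Longrightarrow> 0 < edge_wt B z i j"
  by (simp add: edge_wt_def potts_int_def)

lemma third_spin:
  fixes i i' :: "'q::finite"
  assumes "3 \<le> CARD('q)"
  obtains j where "j \<noteq> i" "j \<noteq> i'"
proof -
  have "card {i, i'} < CARD('q)" using assms by (cases "i = i'") auto
  then have "{i, i'} \<noteq> UNIV" by auto
  then show ?thesis using that by auto
qed

text \<open>The Hessian form is a sum of squares, and its off-diagonal weights are positive even for
  \<open>B = 0\<close>. Hence \<open>fst w $ i = - snd w $ j\<close> for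
  \<open>i \<noteq> j\<close>; a third spin links any two indices, so only multiples of
  \<open>(1, - 1)\<close> remain, and the \<open>mass_gap\<close> term excludes those.\<close>

lemma hess_pot_inj:
  fixes w :: "'q::finite phase"
  assumes "0 \<le> B" "3 \<le> CARD('q)" "hess_pot B z w = 0"
  shows "w = 0"
proof -
  let ?S = "\<Sum>i\<in>UNIV. \<Sum>j\<in>UNIV. edge_wt B z i j * (fst w $ i + snd w $ j)\<^sup>2"
  have nn: "0 \<le> edge_wt B z i j * (fst w $ i + snd w $ j)\<^sup>2" for i j
    by (intro mult_nonneg_nonneg edge_wt_nonneg[OF assms(1)] zero_le_power2)
  have "?S + (mass_gap w)\<^sup>2 = 0"
    using inner_hess_pot[of w B z w] assms(3) by (simp add: power2_eq_square mult.assoc)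
  moreover have "0 \<le> ?S" using nn by (intro sum_nonneg)
  ultimately have S: "?S = 0" and g: "mass_gap w = 0" by (auto simp: add_nonneg_eq_0_iff)
  have "edge_wt B z i j * (fst w $ i + snd w $ j)\<^sup>2 = 0" for i j
  proof -
    have "(\<Sum>j\<in>UNIV. edge_wt B z i j * (fst w $ i + snd w $ j)\<^sup>2) = 0"
      using S nn by (subst (asm) sum_nonneg_eq_0_iff) (auto intro: sum_nonneg)
    then show ?thesis using nn by (subst (asm) sum_nonneg_eq_0_iff) auto
  qed
  then have opp: "fst w $ i = - snd w $ j" if "i \<noteq> j" for i j
    using edge_wt_off_diag[OF that, of B z] by (smt (verit) mult_eq_0_iff zero_eq_power2)
  fix k :: 'q
  have f: "fst w $ i = fst w $ k" for i
  proof -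
    obtain j where "j \<noteq> i" "j \<noteq> k" using third_spin[OF assms(2)] by blast
    then show ?thesis using opp[of i j] opp[of k j] by simp
  qed
  have s: "snd w $ i = - fst w $ k" for i
  proof -
    obtain j where "j \<noteq> i" using third_spin[OF assms(2)] by blast
    then show ?thesis using opp[of j i] f[of j] by simp
  qed
  have "(\<Sum>i\<in>UNIV. fst w $ i) = (\<Sum>i\<in>(UNIV :: 'q set). fst w $ k)"
    by (intro sum.cong refl f)
  then have "fst w $ k = 0" using g by (simp add: mass_gap_def s)
  then have "fst w $ i = 0" "snd w $ i = 0" for i using f[of i] s[of i] by simp_all
  then show ?thesis by (simp add: prod_eq_iff vec_eq_iff)
qed

lemma continuous_on_hess_pot: "continuous_on S (\<lambda>z. hess_pot B z w)"
proof -
  have "continuous_on S (\<lambda>z. edge_wt B z i j)" for i j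
    unfolding edge_wt_def by (intro continuous_intros)
  then show ?thesis unfolding hess_pot_def
    by (intro continuous_on_Pair continuous_on_vec_lambda continuous_intros) auto
qed

lemma bounded_linear_hess_pot: "bounded_linear (hess_pot B z)"
  using has_derivative_grad_pot has_derivative_bounded_linear by blast

text \<open>The properties hold on a whole neighbourhood because \<open>Psi1\<close> has to be
  differentiated at all nearby phases before its gradient is differentiated at the phase
  itself.\<close>

lemma grad_pot_inverse:
  fixes z0 :: "'q::finite phase"
  assumes "0 \<le> B" "3 \<le> CARD('q)"
  obtains V g g' where "open V" "grad_pot B c0 z0 \<in> V" "g (grad_pot B c0 z0) = z0"
    "\<And>y. y \<in> V \<Longrightarrow> grad_pot B c0 (g y) = y"
    "\<And>y. y \<in> V \<Longrightarrow> (g has_derivative g' y) (at y)"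
    "\<And>y w. y \<in> V \<Longrightarrow> hess_pot B (g y) (g' y w) = w"
proof -
  let ?f' = "\<lambda>z :: 'q phase. Blinfun (hess_pot B z)"
  have f': "blinfun_apply (?f' z) = hess_pot B z" for z :: "'q phase"
    by (simp add: bounded_linear_Blinfun_apply bounded_linear_hess_pot)
  have lin: "linear (hess_pot B z0)" using bounded_linear_hess_pot bounded_linear.linear by blast
  have "inj (hess_pot B z0)"
    using hess_pot_inj[OF assms] linear_injective_0[OF lin] by blast
  then obtain h where h: "linear h" "h \<circ> hess_pot B z0 = id"
    using linear_injective_left_inverse[OF lin] by blast
  have "blinfun_apply (Blinfun h) = h"
    using h by (simp add: bounded_linear_Blinfun_apply linear_conv_bounded_linear)
  moreover have "h (hess_pot B z0 v) = v" for v using h(2) by (rule pointfree_idE)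
  ultimately have inv: "Blinfun h o\<^sub>L ?f' z0 = id_blinfun"
    by (intro blinfun_eqI) (simp add: f')
  have cont: "continuous_on UNIV ?f'"
    by (intro continuous_on_blinfun_componentwise) (simp add: f' continuous_on_hess_pot)
  obtain U' V g g' where *: "z0 \<in> U'" "open V" "grad_pot B c0 z0 \<in> V" "homeomorphism U' V (grad_pot B c0) g"
    "\<And>y. y \<in> V \<Longrightarrow> (g has_derivative (g' y)) (at y)"
    "\<And>y. y \<in> V \<Longrightarrow> g' y = inv (blinfun_apply (?f' (g y)))"
    "\<And>y. y \<in> V \<Longrightarrow> bij (blinfun_apply (?f' (g y)))"
    by (rule inverse_function_theorem[OF open_UNIV _ cont UNIV_I inv, of "grad_pot B c0"])
      (auto simp: f' has_derivative_grad_pot)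
  show ?thesis
  proof (rule that[of V g g'])
    show "g (grad_pot B c0 z0) = z0" using *(1,4) by (auto simp: homeomorphism_def)
    show "grad_pot B c0 (g y) = y" if "y \<in> V" for y using that *(4) by (auto simp: homeomorphism_def)
    show "hess_pot B (g y) (g' y w) = w" if "y \<in> V" for y w
      using *(6,7)[OF that] by (simp add: f' bij_is_surj surj_f_inv_f)
  qed (use * in auto)
qed

text \<open>Pairing with \<open>(1, - 1)\<close> cancels all edge weights and leaves the quadratic
  term. Marginals of equal mass therefore force \<open>mass_gap z = c0\<close>.\<close>

lemma mass_gap_grad_pot:
  fixes z :: "'q::finite phase"
  shows "mass_gap (grad_pot B c0 z) = 2 * real CARD('q) * (mass_gap z - c0)"
proof -
  have "mass_gap (grad_pot B c0 z) = inner (1, - 1) (grad_pot B c0 z)"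
    by (simp add: inner_phase mass_gap_def sum_negf)
  also have "\<dots> = 2 * real CARD('q) * (mass_gap z - c0)"
    unfolding inner_grad_pot by (simp add: mass_gap_def)
  finally show ?thesis .
qed

lemma mass_gap_hess_pot:
  fixes z w :: "'q::finite phase"
  shows "mass_gap (hess_pot B z w) = 2 * real CARD('q) * mass_gap w"
proof -
  have "mass_gap (hess_pot B z w) = inner (1, - 1) (hess_pot B z w)"
    by (simp add: inner_phase mass_gap_def sum_negf)
  also have "\<dots> = 2 * real CARD('q) * mass_gap w"
    unfolding inner_hess_pot by (simp add: mass_gap_def)
  finally show ?thesis .
qed

lemma has_derivative_plogp:
  assumes "0 < t"
  shows "(plogp has_real_derivative ln t + 1) (at t)"
proof -
  have "((\<lambda>t. t * ln t) has_real_derivative ln t + 1) (at t)"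
    using assms by (auto intro!: derivative_eq_intros)
  then show ?thesis
  proof (rule has_field_derivative_transform_within_open[where S="{0<..}"])
    show "x * ln x = plogp x" if "x \<in> {0<..}" for x using that by (simp add: plogp_def)
  qed (use assms in auto)
qed

text \<open>The Legendre transform of the potential: as \<open>g y\<close> is a critical point of
  the dual problem, the terms containing \<open>g'\<close> cancel.\<close>

lemma has_derivative_dual:
  fixes g :: "'q::finite phase \<Rightarrow> 'q phase"
  assumes "(g has_derivative g') (at y)" "grad_pot B c0 (g y) = y"
  shows "((\<lambda>y. inner y (g y) - potential B c0 (g y)) has_derivative inner (g y)) (at y)"
proof -
  have "((\<lambda>y. potential B c0 (g y)) has_derivative (\<lambda>w. inner (g' w) y)) (at y)"
    using has_derivative_compose[OF assms(1) has_derivative_potential[of B c0 "g y" UNIV]] assms(2) by simp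
  then have "((\<lambda>y. inner y (g y) - potential B c0 (g y)) has_derivative
      (\<lambda>w. inner y (g' w) + inner w (g y) - inner (g' w) y)) (at y)"
    by (intro has_derivative_diff has_derivative_inner has_derivative_ident assms(1))
  moreover have "(\<lambda>w. inner y (g' w) + inner w (g y) - inner (g' w) y) = inner (g y)"
    by (simp add: fun_eq_iff inner_commute)
  ultimately show ?thesis by (simp only:)
qed

definition pos_phases :: "('q::finite) phase set" where
  "pos_phases = {y. (\<forall>i. 0 < fst y $ i) \<and> (\<forall>i. 0 < snd y $ i)}"

lemma open_pos_phases: "open (pos_phases :: ('q::finite) phase set)"
proof -
  have "pos_phases = (\<Inter>i\<in>UNIV. {y :: 'q phase. 0 < fst y $ i}) \<inter> (\<Inter>i\<in>UNIV. {y. 0 < snd y $ i})"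
    by (auto simp: pos_phases_def)
  also have "open \<dots>"
    by (intro open_Int open_INT ballI open_Collect_less continuous_intros) auto
  finally show ?thesis .
qed

lemma has_derivative_plogp_sum:
  fixes y :: "'q::finite phase"
  assumes "y \<in> pos_phases"
  shows "((\<lambda>y. (\<Sum>i\<in>UNIV. plogp (fst y $ i)) + (\<Sum>j\<in>UNIV. plogp (snd y $ j))) has_derivative
    inner ((\<chi> i. ln (fst y $ i) + 1), (\<chi> j. ln (snd y $ j) + 1))) (at y)"
proof -
  have *: "((\<lambda>y. plogp (fst y $ i)) has_derivative (\<lambda>w. (ln (fst y $ i) + 1) * fst w $ i)) (at y)"
    "((\<lambda>y. plogp (snd y $ i)) has_derivative (\<lambda>w. (ln (snd y $ i) + 1) * snd w $ i)) (at y)" for i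
    using assms
      has_derivative_compose[OF has_derivative_phase_nth(1)[OF has_derivative_ident]
        has_derivative_plogp[of "fst y $ i", unfolded has_field_derivative_def], of UNIV]
      has_derivative_compose[OF has_derivative_phase_nth(2)[OF has_derivative_ident]
        has_derivative_plogp[of "snd y $ i", unfolded has_field_derivative_def], of UNIV]
    by (auto simp: pos_phases_def)
  have "inner ((\<chi> i. ln (fst y $ i) + 1), (\<chi> j. ln (snd y $ j) + 1)) = (\<lambda>w :: 'q phase.
      (\<Sum>i\<in>UNIV. (ln (fst y $ i) + 1) * fst w $ i) + (\<Sum>j\<in>UNIV. (ln (snd y $ j) + 1) * snd w $ j))"
    by (simp add: inner_phase fun_eq_iff)
  then show ?thesis using * by (simp only:) (intro has_derivative_add has_derivative_sum *)
qed

lemma has_derivative_log_field: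
  fixes y :: "'q::finite phase"
  assumes "y \<in> pos_phases"
  shows "((\<lambda>y. ((\<chi> i. ln (fst y $ i) + 1), (\<chi> j. ln (snd y $ j) + 1))) has_derivative
    (\<lambda>w. ((\<chi> i. fst w $ i / fst y $ i), (\<chi> j. snd w $ j / snd y $ j)))) (at y)"
  using assms unfolding pos_phases_def
  by (intro has_derivative_Pair has_derivative_vec_lambda)
    (auto intro!: derivative_eq_intros simp: divide_inverse mult.commute)

text \<open>At a critical point of the Gibbs bound the Hessian of \<open>Psi1\<close> is \<open>n / y\<close> minus \<open>n + 1\<close> times the inverse
  of the Hessian of the potential; the inverse form is bounded below by testing it against
  \<open>n / (n + 1) * w / y\<close>.\<close>
lemma inverse_hessian_bound:
  fixes z w p :: "'q::finite phase"
  assumes B: "0 \<le> B" and n: "0 < n" and p: "p \<in> pos_phases"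
    and marg: "\<And>i. (\<Sum>j\<in>UNIV. edge_wt B z0 i j) = fst p $ i" "\<And>j. (\<Sum>i\<in>UNIV. edge_wt B z0 i j) = snd p $ j"
    and w: "w \<in> tangent_dirs" "w \<noteq> 0" "hess_pot B z0 z = w"
    and form: "\<And>u v. (\<Sum>i\<in>UNIV. fst p $ i * u i) = 0 \<Longrightarrow> (\<Sum>j\<in>UNIV. snd p $ j * v j) = 0 \<Longrightarrow>
      (\<exists>i. u i \<noteq> 0 \<or> v i \<noteq> 0) \<Longrightarrow>
      2 * real n * (\<Sum>i\<in>UNIV. \<Sum>j\<in>UNIV. edge_wt B z0 i j * (u i * v j))
        < (\<Sum>i\<in>UNIV. fst p $ i * (u i)\<^sup>2) + (\<Sum>j\<in>UNIV. snd p $ j * (v j)\<^sup>2)"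
  shows "real n * inner ((\<chi> i. fst w $ i / fst p $ i), (\<chi> j. snd w $ j / snd p $ j)) w < real (n + 1) * inner z w"
proof -
  let ?W = "\<lambda>t. \<Sum>i\<in>UNIV. \<Sum>j\<in>UNIV. edge_wt B z0 i j * t i j"
  define u v where "u i = fst w $ i / fst p $ i" and "v i = snd w $ i / snd p $ i" for i
  define om :: "'q phase" where "om = ((\<chi> i. u i), (\<chi> j. v j))"
  define a b where "a i j = fst z $ i + snd z $ j" and "b i j = u i + v j" for i j
  have pp: "0 < fst p $ i" "0 < snd p $ i" for i using p by (auto simp: pos_phases_def)
  have pu: "fst p $ i * u i = fst w $ i" "snd p $ i * v i = snd w $ i" for i
    using pp[of i] by (simp_all add: u_def v_def)
  have gz: "mass_gap z = 0"
    using mass_gap_hess_pot[of B z0 z] w by (simp add: mass_gap_def tangent_dirs_def)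
  have "inner z w = ?W (\<lambda>i j. (a i j)\<^sup>2)"
    using inner_hess_pot[of z B z0 z] by (simp add: w gz a_def power2_eq_square mult.assoc)
  moreover have "inner om w = ?W (\<lambda>i j. a i j * b i j)"
    using inner_hess_pot[of om B z0 z] by (simp add: w gz a_def b_def om_def mult.assoc)
  moreover define N where "N = inner om w"
  moreover have N: "N = (\<Sum>i\<in>UNIV. fst p $ i * (u i)\<^sup>2) + (\<Sum>j\<in>UNIV. snd p $ j * (v j)\<^sup>2)"
    unfolding N_def inner_phase om_def by (simp add: power2_eq_square mult_ac flip: pu)
  moreover define S where "S = ?W (\<lambda>i j. u i * v j)"
  moreover have "?W (\<lambda>i j. (b i j)\<^sup>2) = N + 2 * S"
  proof -
    have "?W (\<lambda>i j. (b i j)\<^sup>2) = ?W (\<lambda>i j. (u i)\<^sup>2) + ?W (\<lambda>i j. (v j)\<^sup>2) + 2 * S"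
      unfolding S_def sum_distrib_left sum.distrib[symmetric]
      by (intro sum.cong refl) (simp add: b_def power2_sum algebra_simps)
    also have "?W (\<lambda>i j. (u i)\<^sup>2) = (\<Sum>i\<in>UNIV. fst p $ i * (u i)\<^sup>2)"
      by (simp add: marg flip: sum_distrib_right)
    also have "?W (\<lambda>i j. (v j)\<^sup>2) = (\<Sum>j\<in>UNIV. snd p $ j * (v j)\<^sup>2)"
      by (subst sum.swap) (simp add: marg flip: sum_distrib_right)
    finally show ?thesis using N by simp
  qed
  moreover define s where "s = real n / real (n + 1)"
  moreover have "0 \<le> ?W (\<lambda>i j. (a i j - s * b i j)\<^sup>2)"
    by (intro sum_nonneg mult_nonneg_nonneg edge_wt_nonneg[OF B] zero_le_power2)
  moreover have "?W (\<lambda>i j. (a i j - s * b i j)\<^sup>2) = ?W (\<lambda>i j. (a i j)\<^sup>2) - 2 * s * ?W (\<lambda>i j. a i j * b i j)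
      + s\<^sup>2 * ?W (\<lambda>i j. (b i j)\<^sup>2)"
    unfolding sum_distrib_left sum.distrib[symmetric] sum_subtractf[symmetric]
    by (intro sum.cong refl) (simp add: power2_diff power_mult_distrib algebra_simps)
  ultimately have Q: "2 * s * N - s\<^sup>2 * (N + 2 * S) \<le> inner z w" by simp
  have "2 * real n * S < N"
    unfolding N S_def
  proof (rule form)
    show "(\<Sum>i\<in>UNIV. fst p $ i * u i) = 0" "(\<Sum>j\<in>UNIV. snd p $ j * v j) = 0"
      using w by (simp_all add: pu tangent_dirs_def)
    show "\<exists>i. u i \<noteq> 0 \<or> v i \<noteq> 0"
    proof (rule ccontr)
      assume "\<not> ?thesis"
      then have "fst w $ i = 0" "snd w $ i = 0" for i using pu[of i] by auto
      with w(2) show False by (simp add: prod_eq_iff vec_eq_iff)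
    qed
  qed
  then have "real n * (N + 2 * S) < real (n + 1) * N" using n by (simp add: algebra_simps)
  then have "s * (real n * (N + 2 * S)) < s * (real (n + 1) * N)"
    using n by (intro mult_strict_left_mono) (auto simp: s_def)
  also have s: "real (n + 1) * s = real n" by (simp add: s_def)
  then have "s * (real (n + 1) * N) = real n * N" by (metis mult.assoc mult.commute)
  finally have *: "s * (real n * (N + 2 * S)) < real n * N" .
  have "real (n + 1) * (2 * s * N - s\<^sup>2 * (N + 2 * S)) = 2 * (real (n + 1) * s) * N - s * ((real (n + 1) * s) * (N + 2 * S))"
    by (simp add: power2_eq_square algebra_simps)
  also have "\<dots> = 2 * real n * N - s * (real n * (N + 2 * S))" unfolding s ..
  finally have "real n * N < real (n + 1) * (2 * s * N - s\<^sup>2 * (N + 2 * S))" using * by linarith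
  also have "\<dots> \<le> real (n + 1) * inner z w" using Q by (intro mult_left_mono) auto
  finally show ?thesis unfolding N_def om_def u_def v_def .
qed

text \<open>Near \<open>p\<close> the optimal scaling factors are the exponentials of
  \<open>g y\<close>, which gives \<open>Psi1\<close> in closed form on the plane. By Legendre
  duality its gradient is \<open>n\<close> times the gradient of the entropy sums minus
  \<open>(n + 1) * g y\<close>, so only one derivative of \<open>g\<close> is needed.\<close>

theorem hessian_dominantI:
  fixes p :: "'q::finite phase"
  assumes B: "0 \<le> B" and q: "3 \<le> CARD('q)" and n: "0 < n" and dom: "dominant_phase (Suc n) B p"
    and pos: "\<And>i. 0 < r i" "\<And>j. 0 < c j"
    and marg: "\<And>i. (\<Sum>j\<in>UNIV. potts_int B i j * r i * c j) = fst p $ i"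
      "\<And>j. (\<Sum>i\<in>UNIV. potts_int B i j * r i * c j) = snd p $ j"
    and form: "\<And>u v. (\<Sum>i\<in>UNIV. fst p $ i * u i) = 0 \<Longrightarrow> (\<Sum>j\<in>UNIV. snd p $ j * v j) = 0 \<Longrightarrow>
      (\<exists>i. u i \<noteq> 0 \<or> v i \<noteq> 0) \<Longrightarrow>
      2 * real n * (\<Sum>i\<in>UNIV. \<Sum>j\<in>UNIV. potts_int B i j * r i * c j * (u i * v j))
        < (\<Sum>i\<in>UNIV. fst p $ i * (u i)\<^sup>2) + (\<Sum>j\<in>UNIV. snd p $ j * (v j)\<^sup>2)"
  shows "hessian_dominant (Suc n) B p"
proof -
  define z0 :: "'q phase" where "z0 = ((\<chi> i. ln (r i)), (\<chi> j. ln (c j)))"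
  have wt: "edge_wt B z0 i j = potts_int B i j * r i * c j" for i j
    using pos by (simp add: edge_wt_def z0_def exp_add)
  \<comment> \<open>With this value the quadratic term has zero gradient at \<open>z0\<close>, so
    the gradient there is exactly the pair of marginals.\<close>
  define c0 where "c0 = mass_gap z0"
  have z0: "grad_pot B c0 z0 = p"
    by (simp add: grad_pot_def c0_def wt marg prod_eq_iff vec_eq_iff)
  obtain V g g' where V: "open V" "p \<in> V" "g p = z0" and gr: "\<And>y. y \<in> V \<Longrightarrow> grad_pot B c0 (g y) = y"
    and dg: "\<And>y. y \<in> V \<Longrightarrow> (g has_derivative g' y) (at y)"
    and inv: "\<And>y w. y \<in> V \<Longrightarrow> hess_pot B (g y) (g' y w) = w"
    using grad_pot_inverse[OF B q, where ?c0.0 = c0 and ?z0.0 = z0] unfolding z0 by blast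
  have simplex: "p \<in> prob_simplex \<times> prob_simplex" using dom by (simp add: dominant_phase_def)
  then have plane: "p \<in> sum_one_plane" by (auto simp: prob_simplex_def sum_one_plane_def)
  have ppos: "p \<in> pos_phases"
  proof -
    have "0 < (\<Sum>j\<in>UNIV. edge_wt B z0 i j)" "0 < (\<Sum>j\<in>UNIV. edge_wt B z0 j i)" for i
    proof -
      obtain j where "j \<noteq> i" using third_spin[OF q] by blast
      then show "0 < (\<Sum>j\<in>UNIV. edge_wt B z0 i j)" "0 < (\<Sum>j\<in>UNIV. edge_wt B z0 j i)"
        by (auto intro!: sum_pos2[of _ j] edge_wt_off_diag edge_wt_nonneg[OF B])
    qed
    then show ?thesis by (simp add: pos_phases_def wt marg)
  qed
  define W where "W = V \<inter> pos_phases"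
  have W: "open W" "p \<in> W" using V open_pos_phases ppos by (auto simp: W_def)
  define ent where "ent y = (\<Sum>i\<in>UNIV. plogp (fst y $ i)) + (\<Sum>j\<in>UNIV. plogp (snd y $ j))" for y :: "'q phase"
  \<comment> \<open>On the plane the potential at \<open>g y\<close> is the total edge mass 1, so
    \<open>- potential + 1\<close> vanishes there; keeping it makes \<open>L\<close> a Legendre
    transform, differentiable in an open set.\<close>
  define L where "L y = real n * ent y - real (n + 1) * (inner y (g y) - potential B c0 (g y) + 1)" for y
  have Psi: "Psi1 (Suc n) B y = ereal (L y)" if y: "y \<in> W" "y \<in> sum_one_plane" for y
  proof -
    have yV: "y \<in> V" using y by (simp add: W_def)
    have "mass_gap y = 0" using y by (simp add: mass_gap_def sum_one_plane_def)
    then have gap: "mass_gap (g y) = c0" using mass_gap_grad_pot[of B c0 "g y"] by (simp add: gr[OF yV])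
    have m: "(\<Sum>j\<in>UNIV. edge_wt B (g y) i j) = fst y $ i" "(\<Sum>j\<in>UNIV. edge_wt B (g y) j i) = snd y $ i" for i
      using arg_cong[OF gr[OF yV], of "\<lambda>y. fst y $ i"] arg_cong[OF gr[OF yV], of "\<lambda>y. snd y $ i"]
      by (simp_all add: grad_pot_def gap)
    have "potential B c0 (g y) = 1"
      using y by (simp add: potential_def gap m sum_one_plane_def)
    moreover have "Psi1 (Suc n) B y = ereal ((real (Suc n) - 1) * ent y
        - real (Suc n) * ((\<Sum>i\<in>UNIV. fst y $ i * ln (exp (fst (g y) $ i))) + (\<Sum>j\<in>UNIV. snd y $ j * ln (exp (snd (g y) $ j)))))"
      unfolding ent_def using m by (intro Psi1_scaled[OF B]) (simp_all add: edge_wt_def exp_add mult.assoc)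
    ultimately show ?thesis by (simp add: L_def inner_phase)
  qed
  define F :: "'q phase \<Rightarrow> 'q phase" where "F y = real n *\<^sub>R ((\<chi> i. ln (fst y $ i) + 1), (\<chi> j. ln (snd y $ j) + 1)) - real (n + 1) *\<^sub>R g y" for y
  have dL: "(L has_derivative inner (F y)) (at y)" if y: "y \<in> W" for y
  proof -
    have "(L has_derivative (\<lambda>w. real n * inner ((\<chi> i. ln (fst y $ i) + 1), (\<chi> j. ln (snd y $ j) + 1)) w
        - real (n + 1) * (inner (g y) w + 0))) (at y)"
      unfolding L_def [abs_def] ent_def
      using y by (intro has_derivative_diff has_derivative_mult_right has_derivative_add has_derivative_const
          has_derivative_plogp_sum has_derivative_dual[OF dg gr]) (auto simp: W_def)
    moreover have "(\<lambda>w. real n * inner ((\<chi> i. ln (fst y $ i) + 1), (\<chi> j. ln (snd y $ j) + 1)) w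
        - real (n + 1) * (inner (g y) w + 0)) = inner (F y)"
      by (rule ext) (simp only: F_def inner_diff_left inner_scaleR_left add_0_right)
    ultimately show ?thesis by (simp only:)
  qed
  define F' where "F' w = real n *\<^sub>R ((\<chi> i. fst w $ i / fst p $ i), (\<chi> j. snd w $ j / snd p $ j)) - real (n + 1) *\<^sub>R g' p w" for w
  have dF: "(F has_derivative F') (at p)"
    unfolding F_def [abs_def] F'_def [abs_def]
    using W by (intro has_derivative_diff has_derivative_scaleR_right has_derivative_log_field dg) (auto simp: W_def)
  define Df :: "'q phase \<Rightarrow> 'q phase \<Rightarrow>\<^sub>L real" where "Df y = blinfun_inner_left (F y)" for y
  define D2 :: "'q phase \<Rightarrow> 'q phase \<Rightarrow>\<^sub>L real" where "D2 w = blinfun_inner_left (F' w)" for w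
  have near: "\<forall>\<^sub>F y in at p within sum_one_plane. y \<in> W \<and> y \<in> sum_one_plane"
    unfolding eventually_at_topological using W by blast
  have dPsi: "((\<lambda>z. real_of_ereal (Psi1 (Suc n) B z)) has_derivative blinfun_apply (Df y)) (at y within sum_one_plane)"
    if y: "y \<in> W" "y \<in> sum_one_plane" for y
  proof (rule has_derivative_transform_eventually)
    have "blinfun_apply (Df y) = inner (F y)" by (simp add: Df_def fun_eq_iff inner_commute)
    then show "(L has_derivative blinfun_apply (Df y)) (at y within sum_one_plane)"
      using dL[OF y(1)] by (simp add: has_derivative_at_withinI)
    show "\<forall>\<^sub>F x in at y within sum_one_plane. L x = real_of_ereal (Psi1 (Suc n) B x)"
      unfolding eventually_at_topological using W y Psi by (intro exI[of _ W]) auto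
  qed (use Psi y in auto)
  show ?thesis
    unfolding hessian_dominant_def
  proof (intro conjI, rule dom, goal_cases finite deriv)
    case finite
    show ?case using near by eventually_elim (simp add: Psi)
  next
    case deriv
    show ?case
    proof (rule exI[of _ Df], rule exI[of _ D2], intro conjI ballI impI)
    show "\<forall>\<^sub>F y in at p within sum_one_plane.
        ((\<lambda>z. real_of_ereal (Psi1 (Suc n) B z)) has_derivative blinfun_apply (Df y)) (at y within sum_one_plane)"
      using near by eventually_elim (simp add: dPsi)
    show "((\<lambda>z. real_of_ereal (Psi1 (Suc n) B z)) has_derivative blinfun_apply (Df p)) (at p within sum_one_plane)"
      using dPsi W plane by blast
    show "(Df has_derivative (\<lambda>w. D2 w)) (at p within sum_one_plane)"
      unfolding Df_def [abs_def] D2_def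
      by (rule bounded_linear.has_derivative[OF bounded_linear_blinfun_inner_left has_derivative_at_withinI[OF dF]])
    show "blinfun_apply (D2 w) w < 0" if w: "w \<in> tangent_dirs" "w \<noteq> 0" for w
    proof -
      have "real n * inner ((\<chi> i. fst w $ i / fst p $ i), (\<chi> j. snd w $ j / snd p $ j)) w < real (n + 1) * inner (g' p w) w"
      proof (rule inverse_hessian_bound[OF B n ppos, of z0])
        show "hess_pot B z0 (g' p w) = w" using inv[OF V(2)] by (simp only: V(3))
      qed (use form w in \<open>simp_all add: wt marg\<close>)
      moreover have "blinfun_apply (D2 w) w = inner (F' w) w" by (simp add: D2_def inner_commute)
      ultimately show ?thesis unfolding F'_def inner_diff_left inner_scaleR_left by linarith
    qed
    qed
  qed
qed

subsection \<open>The quadratic form at a critical pair\<close>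

context crit_pair
begin

text \<open>Subtracting the critical equations and dividing by \<open>x0 - y0\<close> gives the
  first identity; the recursion for \<open>hsym\<close> then turns \<open>crit_x\<close> into the
  second.\<close>

lemma crit_hsym:
  assumes "x0 \<noteq> y0"
  shows "k = d * hsym (n - 1) x0 y0" and "d * hsym n x0 y0 = 1"
proof -
  have n': "n = Suc (n - 1)" using n by simp
  have "(x0 - y0) * (d * hsym (n - 1) x0 y0) = d * ((x0 - y0) * hsym (n - 1) x0 y0)" by simp
  also have "\<dots> = d * (x0 ^ n - y0 ^ n)" using n' by (simp only: hsym_diff)
  also have "\<dots> = (x0 - y0) * k" using crit_x crit_y by (simp add: algebra_simps)
  finally show k: "k = d * hsym (n - 1) x0 y0" using assms by simp
  have "d * hsym n x0 y0 = x0 * (d * hsym (n - 1) x0 y0) + d * y0 ^ n"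
    using hsym_Suc[of "n - 1" x0 y0] n' by (simp add: algebra_simps)
  also have "\<dots> = 1" using crit_x unfolding k[symmetric] by (simp add: mult.commute)
  finally show "d * hsym n x0 y0 = 1" .
qed

text \<open>Strict AM-GM for \<open>hsym\<close>. The first part is the determinant condition for
  the form of a single spin; the second, combined with
  \<open>(x0 + y0) * (u * v) ^ m \<le> x0 ^ n + y0 ^ n\<close>, serves the averaged
  direction.\<close>

lemma crit_geometric:
  assumes "x0 \<noteq> y0"
  shows crit_det: "(real n * d)\<^sup>2 * (x0 * y0) ^ (n - 1) < k\<^sup>2"
    and crit_trace: "real n * (x0 + y0) * (x0 * y0) ^ (n - 1) < hsym (n - 1) x0 y0 * (x0 ^ n + y0 ^ n)"
proof -
  define u v where "u = sqrt x0" and "v = sqrt y0"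
  have uv: "0 < u" "0 < v" "x0 = u\<^sup>2" "y0 = v\<^sup>2" "u \<noteq> v" using x0 y0 assms by (auto simp: u_def v_def)
  obtain m where m: "n = Suc m" "0 < m" using n by (cases n) auto
  have H: "real n * (u * v) ^ m < hsym m x0 y0"
    using hsym_gt_geometric[OF uv(1,2,5) m(2)] by (simp add: uv m(1))
  have e: "(x0 * y0) ^ m = ((u * v) ^ m)\<^sup>2"
    by (simp add: uv power_mult_distrib mult.commute flip: power_mult)
  have "(real n * (u * v) ^ m)\<^sup>2 < (hsym m x0 y0)\<^sup>2"
    using H uv by (intro power_strict_mono) auto
  then have lt: "d\<^sup>2 * (real n * (u * v) ^ m)\<^sup>2 < d\<^sup>2 * (hsym m x0 y0)\<^sup>2"
    using d by (intro mult_strict_left_mono) auto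
  show "(real n * d)\<^sup>2 * (x0 * y0) ^ (n - 1) < k\<^sup>2"
  proof -
    have "(real n * d)\<^sup>2 * (x0 * y0) ^ m = d\<^sup>2 * (real n * (u * v) ^ m)\<^sup>2"
      unfolding e by (simp only: power_mult_distrib mult_ac)
    moreover have "k\<^sup>2 = d\<^sup>2 * (hsym m x0 y0)\<^sup>2"
      using crit_hsym(1)[OF assms] by (simp add: m(1) power_mult_distrib)
    ultimately show ?thesis using lt by (simp add: m(1) del: of_nat_Suc)
  qed
  have "0 \<le> (u ^ (m + 2) - v ^ (m + 2)) * (u ^ m - v ^ m)"
    using uv power_mono[of u v "m + 2"] power_mono[of v u "m + 2"] power_mono[of u v m] power_mono[of v u m]
    by (cases "u \<le> v") (auto intro: mult_nonneg_nonneg mult_nonpos_nonpos simp del: power_Suc)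
  also have "\<dots> = x0 ^ n + y0 ^ n - (x0 + y0) * (u * v) ^ m"
    by (simp add: uv m(1) power2_eq_square algebra_simps power_mult_distrib)
  finally have A: "(x0 + y0) * (u * v) ^ m \<le> x0 ^ n + y0 ^ n" by simp
  have "real n * (x0 + y0) * (x0 * y0) ^ m = (real n * (u * v) ^ m) * ((x0 + y0) * (u * v) ^ m)"
    unfolding e by (simp add: power2_eq_square)
  also have "\<dots> \<le> (real n * (u * v) ^ m) * (x0 ^ n + y0 ^ n)"
    using A uv by (intro mult_left_mono) auto
  also have "\<dots> < hsym m x0 y0 * (x0 ^ n + y0 ^ n)"
    using H x0 y0 by (intro mult_strict_right_mono add_pos_pos) auto
  finally show "real n * (x0 + y0) * (x0 * y0) ^ (n - 1) < hsym (n - 1) x0 y0 * (x0 ^ n + y0 ^ n)"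
    by (simp add: m(1) del: of_nat_Suc)
qed

text \<open>This is the form in the one averaged direction that the balance constraint leaves.
  Clearing denominators with \<open>n * A\<close> and replacing \<open>(x0 - y0)\<^sup>2\<close> by
  means of \<open>d * hsym n x0 y0 = 1\<close> reduces it to \<open>crit_trace\<close>.\<close>

lemma crit_average_form:
  assumes "x0 \<noteq> y0" "Q * (x0 ^ n + y0 ^ n) = 2"
  shows "Q / 2 * (x0 * y0) ^ (n - 1) * (x0 - y0)\<^sup>2 < k / real n * (x0 ^ (n + 1) + y0 ^ (n + 1)) - 2 * d * (x0 * y0) ^ n"
    (is "?l < ?r")
proof -
  define e A R H where "e = (x0 * y0) ^ (n - 1)" and "A = x0 ^ n + y0 ^ n"
    and "R = x0 ^ (n + 1) + y0 ^ (n + 1)" and "H = hsym (n - 1) x0 y0"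
  have e: "(x0 * y0) ^ n = x0 * y0 * e" using n by (simp add: e_def flip: power_Suc)
  have pos: "0 < A" "0 < R" using x0 y0 by (auto simp: A_def R_def intro!: add_pos_pos)
  have Q: "Q * A = 2" using assms by (simp add: A_def)
  have sq: "(x0 - y0)\<^sup>2 = d * ((x0 ^ (n + 1) - y0 ^ (n + 1)) * (x0 - y0))"
  proof -
    have "(x0 - y0)\<^sup>2 = (d * hsym n x0 y0) * (x0 - y0)\<^sup>2" using crit_hsym(2)[OF assms(1)] by simp
    also have "\<dots> = d * (((x0 - y0) * hsym n x0 y0) * (x0 - y0))" by (simp add: power2_eq_square)
    finally show ?thesis unfolding hsym_diff by simp
  qed
  have merge: "2 * (x0 * y0) * A + (x0 ^ (n + 1) - y0 ^ (n + 1)) * (x0 - y0) = (x0 + y0) * R"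
    by (simp add: A_def R_def algebra_simps)
  have "real n * A * (?r - ?l) = A * (k * R) - real n * d * (2 * (x0 * y0) * A) * e - real n * (Q * A / 2) * e * (x0 - y0)\<^sup>2"
    using n unfolding e e_def[symmetric] R_def[symmetric] by (simp add: field_simps)
  also have "\<dots> = A * (d * H * R) - real n * d * e * (2 * (x0 * y0) * A + (x0 ^ (n + 1) - y0 ^ (n + 1)) * (x0 - y0))"
    unfolding Q sq crit_hsym(1)[OF assms(1), folded H_def] by (simp add: algebra_simps)
  also have "\<dots> = d * R * (H * A - real n * (x0 + y0) * e)"
    unfolding merge by (simp add: algebra_simps)
  also have "0 < \<dots>"
    using d pos crit_trace[OF assms(1)] by (intro mult_pos_pos) (auto simp: e_def A_def H_def)
  finally have "0 < real n * A * (?r - ?l)" .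
  moreover have "0 < real n * A" using n pos by simp
  ultimately have "0 < ?r - ?l" by (rule zero_less_mult_pos)
  then show ?thesis by (simp only: diff_gt_0_iff_gt)
qed

end

lemma quadratic_pos:
  fixes a b c s t :: real
  assumes "0 < a" "c\<^sup>2 < a * b"
  shows "0 \<le> a * s\<^sup>2 + b * t\<^sup>2 + 2 * c * s * t"
    and "s \<noteq> 0 \<or> t \<noteq> 0 \<Longrightarrow> 0 < a * s\<^sup>2 + b * t\<^sup>2 + 2 * c * s * t"
proof -
  have eq: "a * (a * s\<^sup>2 + b * t\<^sup>2 + 2 * c * s * t) = (a * s + c * t)\<^sup>2 + (a * b - c\<^sup>2) * t\<^sup>2"
    by (simp add: power2_eq_square algebra_simps)
  have pos: "0 < a * (a * s\<^sup>2 + b * t\<^sup>2 + 2 * c * s * t)" if "s \<noteq> 0 \<or> t \<noteq> 0"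
  proof (cases "t = 0")
    case True
    then show ?thesis using that assms unfolding eq by simp
  next
    case False
    then show ?thesis using assms unfolding eq by (intro add_nonneg_pos) auto
  qed
  then show *: "s \<noteq> 0 \<or> t \<noteq> 0 \<Longrightarrow> 0 < a * s\<^sup>2 + b * t\<^sup>2 + 2 * c * s * t"
    using assms by (simp add: zero_less_mult_iff)
  show "0 \<le> a * s\<^sup>2 + b * t\<^sup>2 + 2 * c * s * t" using * by (cases "s = 0 \<and> t = 0") auto
qed

text \<open>Jensen's inequality for a positive definite form, by expanding the sum of its values at
  the deviations from the mean, scaled by the number of spins.\<close>

lemma sum_quadratic_average:
  fixes \<xi> \<eta> :: "'q::finite \<Rightarrow> real" and a b c :: real
  defines "\<Xi> \<equiv> \<Sum>i\<in>UNIV. \<xi> i" and "H \<equiv> \<Sum>i\<in>UNIV. \<eta> i"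
  assumes "0 < a" "c\<^sup>2 < a * b"
  shows "a * \<Xi>\<^sup>2 + b * H\<^sup>2 + 2 * c * \<Xi> * H \<le> real CARD('q) * (\<Sum>i\<in>UNIV. a * (\<xi> i)\<^sup>2 + b * (\<eta> i)\<^sup>2 + 2 * c * \<xi> i * \<eta> i)"
proof -
  let ?Q = "real CARD('q)"
  have "0 \<le> (\<Sum>i\<in>UNIV. a * (?Q * \<xi> i - \<Xi>)\<^sup>2 + b * (?Q * \<eta> i - H)\<^sup>2 + 2 * c * (?Q * \<xi> i - \<Xi>) * (?Q * \<eta> i - H))"
    by (intro sum_nonneg quadratic_pos(1) assms)
  also have "\<dots> = (\<Sum>i\<in>UNIV. ?Q\<^sup>2 * (a * (\<xi> i)\<^sup>2 + b * (\<eta> i)\<^sup>2 + 2 * c * \<xi> i * \<eta> i)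
      - 2 * ?Q * (a * \<Xi> + c * H) * \<xi> i - 2 * ?Q * (b * H + c * \<Xi>) * \<eta> i + (a * \<Xi>\<^sup>2 + b * H\<^sup>2 + 2 * c * \<Xi> * H))"
    by (intro sum.cong refl) (simp add: power2_eq_square algebra_simps)
  also have "\<dots> = ?Q * (?Q * (\<Sum>i\<in>UNIV. a * (\<xi> i)\<^sup>2 + b * (\<eta> i)\<^sup>2 + 2 * c * \<xi> i * \<eta> i)
      - (a * \<Xi>\<^sup>2 + b * H\<^sup>2 + 2 * c * \<Xi> * H))"
    unfolding sum.distrib[of _ "\<lambda>_. a * \<Xi>\<^sup>2 + b * H\<^sup>2 + 2 * c * \<Xi> * H"] sum_subtractf sum_distrib_left[symmetric]
      \<Xi>_def[symmetric] H_def[symmetric]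
    by (simp add: power2_eq_square algebra_simps)
  finally show ?thesis by (simp add: zero_le_mult_iff)
qed

context crit_pair
begin

text \<open>The left side sees only the two totals. If these vanish, strictness comes from
  definiteness at a single spin; otherwise averaging passes to the totals, which \<open>bal\<close>
  confines to one line, where \<open>crit_average_form\<close> is strict.\<close>

lemma crit_quadratic_form:
  fixes \<xi> \<eta> :: "'q::finite \<Rightarrow> real"
  assumes ne: "x0 \<noteq> y0" and Q: "real CARD('q) * (x0 ^ n + y0 ^ n) = 2"
    and bal: "x0 ^ (n + 1) * (\<Sum>i\<in>UNIV. \<xi> i) + y0 ^ (n + 1) * (\<Sum>i\<in>UNIV. \<eta> i) = 0"
    and nz: "\<exists>i. \<xi> i \<noteq> 0 \<or> \<eta> i \<noteq> 0"
  shows "(x0 ^ n * (\<Sum>i\<in>UNIV. \<xi> i) + y0 ^ n * (\<Sum>i\<in>UNIV. \<eta> i))\<^sup>2 / 2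
    < (\<Sum>i\<in>UNIV. k / real n * x0 ^ (n + 1) * (\<xi> i)\<^sup>2 + k / real n * y0 ^ (n + 1) * (\<eta> i)\<^sup>2
        + 2 * (d * (x0 * y0) ^ n) * \<xi> i * \<eta> i)"
proof -
  let ?Q = "real CARD('q)"
  define a b c where "a = k / real n * x0 ^ (n + 1)" and "b = k / real n * y0 ^ (n + 1)" and "c = d * (x0 * y0) ^ n"
  define \<Xi> H where "\<Xi> = (\<Sum>i\<in>UNIV. \<xi> i)" and "H = (\<Sum>i\<in>UNIV. \<eta> i)"
  define S where "S = (\<Sum>i\<in>UNIV. a * (\<xi> i)\<^sup>2 + b * (\<eta> i)\<^sup>2 + 2 * c * \<xi> i * \<eta> i)"
  define w where "w = x0 * y0"
  have w: "0 < w" using x0 y0 by (simp add: w_def)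
  have w_pow: "w ^ n = w * w ^ (n - 1)" using n by (simp flip: power_Suc)
  have a: "0 < a" using k n x0 by (simp add: a_def)
  have ab: "c\<^sup>2 < a * b"
  proof -
    have "(real n)\<^sup>2 * c\<^sup>2 = ((real n * d)\<^sup>2 * w ^ (n - 1)) * w ^ (n + 1)"
      by (simp add: c_def power_mult_distrib w_pow power2_eq_square flip: w_def)
    also have "\<dots> < k\<^sup>2 * w ^ (n + 1)"
      using crit_det[OF ne] w by (intro mult_strict_right_mono) (auto simp: w_def)
    also have "\<dots> = (real n)\<^sup>2 * (a * b)"
      using n by (simp add: a_def b_def w_def power2_eq_square power_mult_distrib)
    finally show ?thesis using n by (simp add: mult_less_cancel_left)
  qed
  have "(x0 ^ n * \<Xi> + y0 ^ n * H)\<^sup>2 / 2 < S"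
  proof (cases "\<Xi> = 0")
    case True
    then have "H = 0" using bal y0 by (simp add: \<Xi>_def[symmetric] H_def[symmetric])
    moreover obtain i where "\<xi> i \<noteq> 0 \<or> \<eta> i \<noteq> 0" using nz by blast
    then have "0 < S" unfolding S_def
      by (intro sum_pos2[of _ i] quadratic_pos[OF a ab]) auto
    ultimately show ?thesis using True by simp
  next
    case False
    define \<tau> where "\<tau> = \<Xi> / y0 ^ (n + 1)"
    have \<tau>: "\<Xi> = y0 ^ (n + 1) * \<tau>" "\<tau> \<noteq> 0" using y0 False by (auto simp: \<tau>_def)
    have H: "H = - (x0 ^ (n + 1) * \<tau>)"
    proof -
      have "y0 ^ (n + 1) * (H + x0 ^ (n + 1) * \<tau>) = 0"
        using bal unfolding \<Xi>_def[symmetric] H_def[symmetric] \<tau>(1) by (simp add: algebra_simps)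
      then show ?thesis using y0 by simp
    qed
    have "?Q * ((x0 ^ n * \<Xi> + y0 ^ n * H)\<^sup>2 / 2) = \<tau>\<^sup>2 * w ^ (n + 1) * (?Q / 2 * w ^ (n - 1) * (x0 - y0)\<^sup>2)"
    proof -
      have "x0 ^ n * \<Xi> + y0 ^ n * H = w ^ n * \<tau> * (y0 - x0)"
        unfolding \<tau>(1) H w_def by (simp add: power_mult_distrib algebra_simps)
      moreover have "(w ^ n)\<^sup>2 = w ^ (n + 1) * w ^ (n - 1)"
        by (simp add: power2_eq_square w_pow)
      ultimately show ?thesis
        by (simp only: power_mult_distrib power2_commute[of y0]) (simp add: mult_ac)
    qed
    also have "\<dots> < \<tau>\<^sup>2 * w ^ (n + 1) * (k / real n * (x0 ^ (n + 1) + y0 ^ (n + 1)) - 2 * d * w ^ n)"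
      using crit_average_form[OF ne Q] w \<tau> by (intro mult_strict_left_mono) (auto simp: w_def)
    also have "\<dots> = a * \<Xi>\<^sup>2 + b * H\<^sup>2 + 2 * c * \<Xi> * H"
      unfolding \<tau>(1) H a_def b_def c_def w_def by (simp add: power2_eq_square power_mult_distrib algebra_simps)
    also have "\<dots> \<le> ?Q * S"
      unfolding \<Xi>_def H_def S_def by (rule sum_quadratic_average[OF a ab])
    finally show ?thesis by (simp add: mult_less_cancel_left del: times_divide_eq_right)
  qed
  then show ?thesis unfolding S_def \<Xi>_def H_def a_def b_def c_def .
qed

end

subsection \<open>Existence of critical pairs\<close>

lemma bernoulli_strict:
  fixes t :: real
  assumes "0 \<le> t" "t \<noteq> 1" "2 \<le> N"
  shows "1 - real N * (1 - t) < t ^ N"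
proof -
  obtain m where m: "N = Suc m" "0 < m" using assms by (cases N) auto
  show ?thesis using young_power_strict[of 1 t m] assms m by (simp add: algebra_simps)
qed

text \<open>Inserting \<open>d * y ^ n = 1 - k * x\<close> bounds \<open>d * x ^ n\<close> by
  \<open>1 - n * (1 - k * x)\<close>, the tangent at 1 of the \<open>n\<close>-th power evaluated at
  \<open>k * x\<close>; Bernoulli is strict since \<open>k * x \<noteq> 1\<close>.\<close>

lemma less_power_of_crit:
  fixes x y d k :: real
  assumes "2 \<le> n" "0 < d" "0 < x" "0 < y" "0 < k" "1 - d * y ^ n = k * x" "d * (x ^ n + real n * y ^ n) \<le> 1"
  shows "d < k ^ n"
proof -
  have "d * x ^ n \<le> 1 - real n * (1 - k * x)" using assms by (simp add: algebra_simps flip: assms(6))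
  also have "\<dots> < (k * x) ^ n"
  proof (rule bernoulli_strict)
    have "0 < d * y ^ n" using assms by simp
    then show "k * x \<noteq> 1" using assms(6) by linarith
  qed (use assms in auto)
  finally show ?thesis using assms by (simp add: power_mult_distrib)
qed

text \<open>The normalization forces \<open>s ^ n = 1 / Q\<close>, and the threshold hypothesis
  becomes precisely the stability condition \<open>diag\<close> of the locale.\<close>

lemma crit_pair_diagonal:
  fixes d Q :: real
  assumes "2 \<le> n" "0 < d" "0 < Q" "d * real (n + 1) \<le> Q"
  obtains k s where "crit_pair n d k s s" "Q * (s ^ n + s ^ n) = 2"
proof -
  define s where "s = root n (1 / Q)"
  have s: "0 < s" "s ^ n = 1 / Q" using assms by (auto simp: s_def)
  have small: "d * real (n + 1) * s ^ n \<le> 1"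
    using mult_right_mono[OF assms(4), of "s ^ n"] assms s by simp
  have dn: "d * s ^ n < 1"
  proof -
    have "d * s ^ n * 1 < d * s ^ n * real (n + 1)" using assms s by (intro mult_strict_left_mono) auto
    then show ?thesis using small by (simp add: mult_ac)
  qed
  define k where "k = (1 - d * s ^ n) / s"
  have k: "0 < k" "1 - d * s ^ n = k * s" using s dn by (auto simp: k_def)
  have "d < k ^ n"
    using assms s k small by (intro less_power_of_crit[of n d s s]) (auto simp: algebra_simps)
  then have "crit_pair n d k s s" using assms s k small by unfold_locales auto
  then show ?thesis using that[of k s] s assms by simp
qed

lemma hsym_ge:
  assumes "0 < y" "y \<le> x"
  shows "x ^ n + real n * y ^ n \<le> hsym n x y"
proof -
  have "(\<Sum>i<n. y ^ n) \<le> (\<Sum>i<n. x ^ i * y ^ (n - i))"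
  proof (rule sum_mono)
    fix i assume "i \<in> {..<n}"
    then have "y ^ n = y ^ i * y ^ (n - i)" by (simp flip: power_add)
    also have "\<dots> \<le> x ^ i * y ^ (n - i)" using assms by (intro mult_right_mono power_mono) auto
    finally show "y ^ n \<le> x ^ i * y ^ (n - i)" .
  qed
  moreover have "hsym n x y = (\<Sum>i<n. x ^ i * y ^ (n - i)) + x ^ n"
    by (simp add: hsym_def flip: lessThan_Suc_atMost)
  ultimately show ?thesis by simp
qed

lemma crit_pair_off_diagonal:
  fixes d Q :: real
  assumes "2 \<le> n" "0 < d" "d \<le> 1" "4 \<le> Q" "Q < d * real (n + 1)"
  obtains k x y where "crit_pair n d k x y" "y < x" "Q * (x ^ n + y ^ n) = 2"
proof -
  \<comment> \<open>The conditions \<open>d * hsym n x y = 1\<close> and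
    \<open>Q * (x ^ n + y ^ n) = 2\<close> are homogeneous of degree \<open>n\<close>; eliminating
    the scale leaves \<open>f \<rho> = 0\<close> for the ratio
    \<open>\<rho> = x / y\<close>.\<close>
  define f where "f \<rho> = Q * (1 + \<rho> ^ n) - 2 * d * hsym n \<rho> 1" for \<rho>
  have "hsym n 1 1 = real (n + 1)" by (simp add: hsym_def)
  then have f1: "f 1 < 0" using assms by (simp add: f_def)
  \<comment> \<open>The endpoint 2 works because \<open>4 * 2 ^ n - 2 < 4 * (1 + 2 ^ n)\<close>,
    which uses \<open>4 \<le> Q\<close> and \<open>d \<le> 1\<close>; the sign at 1 is the threshold
    condition.\<close>
  have H21: "hsym n 2 1 = 2 * 2 ^ n - 1" using hsym_diff[of 2 1 n] by simp
  have "f 2 = Q * (1 + 2 ^ n) - d * (4 * 2 ^ n - 2)" unfolding f_def H21 by (simp add: algebra_simps)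
  moreover have "d * (4 * 2 ^ n - 2) \<le> 1 * (4 * 2 ^ n - 2)"
  proof (rule mult_right_mono[OF assms(3)])
    show "(0::real) \<le> 4 * 2 ^ n - 2" using one_le_power[of "2::real" n] by linarith
  qed
  moreover have "4 * (1 + 2 ^ n) \<le> Q * (1 + 2 ^ n)" using assms by (intro mult_right_mono) auto
  ultimately have f2: "0 < f 2" by simp
  have "continuous_on {1..2} f" unfolding f_def hsym_def by (intro continuous_intros)
  then obtain \<rho> where \<rho>: "1 \<le> \<rho>" "\<rho> \<le> 2" "f \<rho> = 0" using IVT'[of f 1 0 2] f1 f2 by auto
  have \<rho>1: "1 < \<rho>" using \<rho> f1 by (cases "\<rho> = 1") auto
  define y where "y = root n (2 / (Q * (1 + \<rho> ^ n)))"
  define x where "x = \<rho> * y"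
  have P: "0 < Q * (1 + \<rho> ^ n)" using assms \<rho>1 by (intro mult_pos_pos add_pos_pos) auto
  have y: "0 < y" "y ^ n = 2 / (Q * (1 + \<rho> ^ n))" using assms P by (auto simp: y_def)
  have yP: "y ^ n * (Q * (1 + \<rho> ^ n)) = 2" using y(2) P by (subst (asm) nonzero_eq_divide_eq) auto
  have xy: "y < x" using \<rho>1 y by (simp add: x_def)
  have norm: "Q * (x ^ n + y ^ n) = 2"
  proof -
    have "Q * (x ^ n + y ^ n) = y ^ n * (Q * (1 + \<rho> ^ n))" by (simp add: x_def power_mult_distrib algebra_simps)
    also have "\<dots> = 2" by (rule yP)
    finally show ?thesis .
  qed
  have H: "d * hsym n x y = 1"
  proof -
    have "hsym n x y = y ^ n * hsym n \<rho> 1" using hsym_scale[of n y \<rho> 1] by (simp add: x_def mult.commute)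
    then have "2 * (d * hsym n x y) = y ^ n * (2 * d * hsym n \<rho> 1)" by simp
    also have "2 * d * hsym n \<rho> 1 = Q * (1 + \<rho> ^ n)" using \<rho> by (simp add: f_def)
    also have "y ^ n * (Q * (1 + \<rho> ^ n)) = 2" by (rule yP)
    finally show ?thesis by simp
  qed
  define k where "k = d * hsym (n - 1) x y"
  have k: "0 < k" using assms y xy hsym_pos[of x y] by (simp add: k_def)
  have n': "n = Suc (n - 1)" using assms by simp
  have h: "hsym n x y = x * hsym (n - 1) x y + y ^ n" "hsym n x y = y * hsym (n - 1) x y + x ^ n"
    using hsym_Suc[of "n - 1" x y] hsym_Suc[of "n - 1" y x] hsym_commute[of n x y] hsym_commute[of "n - 1" x y] n'
    by simp_all
  have crit: "1 - d * y ^ n = k * x" "1 - d * x ^ n = k * y"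
    using H[unfolded h(1)] H[unfolded h(2)] by (simp_all add: k_def algebra_simps)
  have "d * (x ^ n + real n * y ^ n) \<le> d * hsym n x y"
    using hsym_ge[of y x n] y xy assms by (intro mult_left_mono) auto
  then have "d < k ^ n"
    using assms y xy k crit H by (intro less_power_of_crit[of n d x y]) auto
  then have "crit_pair n d k x y" using assms y xy k crit by unfold_locales auto
  then show ?thesis using that xy norm by blast
qed

subsection \<open>Dominant phases\<close>

definition two_phase :: "real \<Rightarrow> real \<Rightarrow> 'q::finite set \<Rightarrow> 'q phase" where
  "two_phase a b T = ((\<chi> i. if i \<in> T then a else b), (\<chi> i. if i \<in> T then b else a))"

context crit_pair
begin

definition balanced :: "'q::finite set \<Rightarrow> bool" where
  "balanced T \<longleftrightarrow> x0 = y0 \<or> 2 * card T = CARD('q)"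

lemma sum_balanced:
  fixes T :: "'q::finite set" and f :: "real \<Rightarrow> real"
  assumes "balanced T"
  shows "(\<Sum>i\<in>UNIV. f (if i \<in> T then x0 else y0)) = real CARD('q) * (f x0 + f y0) / 2"
    and "(\<Sum>i\<in>UNIV. f (if i \<in> T then y0 else x0)) = real CARD('q) * (f x0 + f y0) / 2"
proof -
  have *: "(\<Sum>i\<in>UNIV. f (if i \<in> T then a else b)) = real CARD('q) * (f a + f b) / 2"
    if "a = b \<or> 2 * card T = CARD('q)" for a b
  proof -
    have "(\<Sum>i\<in>UNIV. f (if i \<in> T then a else b)) = (\<Sum>i\<in>UNIV. f b + (if i \<in> T then f a - f b else 0))"
      by (intro sum.cong) auto
    also have "\<dots> = real CARD('q) * f b + real (card T) * (f a - f b)"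
      by (simp add: sum.distrib flip: sum.inter_filter)
    also have "\<dots> = real CARD('q) * (f a + f b) / 2"
    proof (cases "a = b")
      case False
      then have "real CARD('q) = 2 * real (card T)" using that by linarith
      then show ?thesis by (simp add: algebra_simps)
    qed simp
    finally show ?thesis .
  qed
  show "(\<Sum>i\<in>UNIV. f (if i \<in> T then x0 else y0)) = real CARD('q) * (f x0 + f y0) / 2"
    "(\<Sum>i\<in>UNIV. f (if i \<in> T then y0 else x0)) = real CARD('q) * (f x0 + f y0) / 2"
    using *[of x0 y0] *[of y0 x0] assms by (auto simp: balanced_def add.commute)
qed

context
  fixes B L :: real and X Y :: "'q::finite set \<Rightarrow> 'q \<Rightarrow> real" and P :: "'q set \<Rightarrow> 'q phase"
  assumes d_eq: "d = 1 - B" and B: "0 \<le> B" and Q: "real CARD('q) * (x0 ^ n + y0 ^ n) = 2"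
  defines "L \<equiv> len (real CARD('q))"
    and "X \<equiv> \<lambda>T i. L * (if i \<in> T then x0 else y0)" and "Y \<equiv> \<lambda>T i. L * (if i \<in> T then y0 else x0)"
    and "P \<equiv> two_phase ((L * x0) ^ Suc n) ((L * y0) ^ Suc n)"
begin

lemma L_pos: "0 < L"
  using len_pos[OF _ Q] by (simp add: L_def)

lemma XY_pos: "0 < X T i" "0 < Y T i"
  using L_pos x0 y0 by (auto simp: X_def Y_def)

lemma phase_power: "fst (P T) $ i = X T i ^ Suc n" "snd (P T) $ i = Y T i ^ Suc n"
  by (auto simp: P_def two_phase_def X_def Y_def)

lemma two_phase_simplex:
  assumes "balanced T"
  shows "P T \<in> prob_simplex \<times> prob_simplex"
proof -
  have "(\<Sum>i\<in>UNIV. X T i ^ Suc n) = 1" "(\<Sum>i\<in>UNIV. Y T i ^ Suc n) = 1"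
  proof -
    have "real CARD('q) * ((L * x0) ^ Suc n + (L * y0) ^ Suc n)
        = L ^ (n + 1) * (real CARD('q) * (x0 ^ (n + 1) + y0 ^ (n + 1)))"
      by (simp add: power_mult_distrib algebra_simps)
    also have "\<dots> = 2" using len_power[OF _ Q] by (simp add: L_def)
    finally show "(\<Sum>i\<in>UNIV. X T i ^ Suc n) = 1" "(\<Sum>i\<in>UNIV. Y T i ^ Suc n) = 1"
      using sum_balanced[OF assms, of "\<lambda>t. (L * t) ^ Suc n"] by (simp_all only: X_def Y_def)
  qed
  moreover have "0 \<le> X T i ^ Suc n" "0 \<le> Y T i ^ Suc n" for i
    using XY_pos[of T i] by (auto intro!: zero_le_power less_imp_le simp del: power_Suc)
  ultimately show ?thesis by (auto simp: prob_simplex_def mem_Times_iff phase_power simp del: power_Suc)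
qed

text \<open>Balance makes both sums of \<open>n\<close>-th powers equal to \<open>L ^ n\<close>. A
  row sum is thus \<open>X T i ^ n * (L ^ n - d * Y T i ^ n)\<close>, and the critical equation
  turns the bracket into a multiple of \<open>X T i\<close>.\<close>

lemma two_phase_marginals:
  assumes "balanced T"
  shows "(\<Sum>j\<in>UNIV. potts_int B i j * X T i ^ n * Y T j ^ n) = k * L ^ (n - 1) * fst (P T) $ i"
    and "(\<Sum>j\<in>UNIV. potts_int B j i * X T j ^ n * Y T i ^ n) = k * L ^ (n - 1) * snd (P T) $ i"
proof -
  have sums: "(\<Sum>j\<in>UNIV. X T j ^ n) = L ^ n" "(\<Sum>j\<in>UNIV. Y T j ^ n) = L ^ n"
  proof -
    have "real CARD('q) * ((L * x0) ^ n + (L * y0) ^ n) = L ^ n * (real CARD('q) * (x0 ^ n + y0 ^ n))"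
      by (simp add: power_mult_distrib algebra_simps)
    then show "(\<Sum>j\<in>UNIV. X T j ^ n) = L ^ n" "(\<Sum>j\<in>UNIV. Y T j ^ n) = L ^ n"
      unfolding Q using sum_balanced[OF assms, of "\<lambda>t. (L * t) ^ n"] by (simp_all only: X_def Y_def)
  qed
  have Ln: "L ^ n = L ^ (n - 1) * L" using n by (simp flip: power_Suc2)
  have crit: "L ^ n - d * (L * a) ^ n = k * L ^ (n - 1) * (L * b)" if "1 - d * a ^ n = k * b" for a b
  proof -
    have "L ^ n - d * (L * a) ^ n = L ^ n * (1 - d * a ^ n)" by (simp add: power_mult_distrib algebra_simps)
    then show ?thesis unfolding that Ln by simp
  qed
  have cx: "L ^ n - d * Y T i ^ n = k * L ^ (n - 1) * X T i" and cy: "L ^ n - d * X T i ^ n = k * L ^ (n - 1) * Y T i"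
    using crit[OF crit_x] crit[OF crit_y] by (simp_all add: X_def Y_def)
  have "(\<Sum>j\<in>UNIV. potts_int B i j * X T i ^ n * Y T j ^ n) = X T i ^ n * (\<Sum>j\<in>UNIV. potts_int B i j * Y T j ^ n)"
    by (simp add: sum_distrib_left mult_ac)
  also have "\<dots> = k * L ^ (n - 1) * fst (P T) $ i"
    unfolding potts_int_sum sums d_eq[symmetric] cx phase_power by simp
  finally show "(\<Sum>j\<in>UNIV. potts_int B i j * X T i ^ n * Y T j ^ n) = k * L ^ (n - 1) * fst (P T) $ i" .
  have "(\<Sum>j\<in>UNIV. potts_int B j i * X T j ^ n * Y T i ^ n) = Y T i ^ n * (\<Sum>j\<in>UNIV. potts_int B i j * X T j ^ n)"
    by (simp add: sum_distrib_left mult_ac potts_int_commute[of B i])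
  also have "\<dots> = k * L ^ (n - 1) * snd (P T) $ i"
    unfolding potts_int_sum sums d_eq[symmetric] cy phase_power by simp
  finally show "(\<Sum>j\<in>UNIV. potts_int B j i * X T j ^ n * Y T i ^ n) = k * L ^ (n - 1) * snd (P T) $ i" .
qed

lemma potts_bilinear:
  fixes f g :: "'q \<Rightarrow> real"
  shows "(\<Sum>i\<in>UNIV. \<Sum>j\<in>UNIV. potts_int B i j * f i * g j)
    = (\<Sum>i\<in>UNIV. f i) * (\<Sum>j\<in>UNIV. g j) - d * (\<Sum>i\<in>UNIV. f i * g i)"
proof -
  have "(\<Sum>i\<in>UNIV. \<Sum>j\<in>UNIV. potts_int B i j * f i * g j) = (\<Sum>i\<in>UNIV. f i * (\<Sum>j\<in>UNIV. potts_int B i j * g j))"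
    by (simp add: sum_distrib_left mult_ac)
  also have "\<dots> = (\<Sum>i\<in>UNIV. f i * (\<Sum>j\<in>UNIV. g j) - d * (f i * g i))"
    unfolding potts_int_sum by (intro sum.cong) (auto simp: d_eq algebra_simps)
  finally show ?thesis unfolding sum_subtractf sum_distrib_left[symmetric] sum_distrib_right[symmetric] .
qed

lemma M_pos: "0 < k * L ^ (n - 1)"
  using k L_pos by simp

lemma simplex_roots:
  assumes "p \<in> prob_simplex \<times> (prob_simplex :: (real ^ 'q) set)"
  defines "U \<equiv> \<lambda>i. root (Suc n) (fst p $ i)" and "V \<equiv> \<lambda>i. root (Suc n) (snd p $ i)"
  shows "0 \<le> U i" "0 \<le> V i" "fst p $ i = U i ^ Suc n" "snd p $ i = V i ^ Suc n"
    "(\<Sum>i\<in>UNIV. U i ^ (n + 1)) = 1" "(\<Sum>i\<in>UNIV. V i ^ (n + 1)) = 1"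
  using assms by (auto simp: prob_simplex_def simp del: power_Suc)

lemma Psi1_le_max:
  assumes p: "p \<in> prob_simplex \<times> (prob_simplex :: (real ^ 'q) set)"
  shows "Psi1 (Suc n) B p \<le> ereal (real (Suc n) * ln (k * L ^ (n - 1)))"
    and "ereal (real (Suc n) * ln (k * L ^ (n - 1))) \<le> Psi1 (Suc n) B p \<Longrightarrow> \<exists>T. balanced T \<and> p = P T"
proof -
  define U V where "U i = root (Suc n) (fst p $ i)" and "V i = root (Suc n) (snd p $ i)" for i
  note UV = simplex_roots[OF p, folded U_def V_def]
  have n0: "0 < n" using n by simp
  note le = bilinear_form_le[OF Q UV(1,2,5,6), folded L_def, folded potts_bilinear]
  show "Psi1 (Suc n) B p \<le> ereal (real (Suc n) * ln (k * L ^ (n - 1)))"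
    using Psi1_le_ln[OF B n0 UV(1,3,2,4) p le(1)] .
  assume "ereal (real (Suc n) * ln (k * L ^ (n - 1))) \<le> Psi1 (Suc n) B p"
  note ge = Psi1_ge_ln_imp[OF B n0 UV(1,3,2,4) p M_pos this]
  obtain T where T: "x0 = y0 \<or> 2 * card T = CARD('q)"
    "\<forall>i. U i = L * (if i \<in> T then x0 else y0)" "\<forall>i. V i = L * (if i \<in> T then y0 else x0)"
    using le(2)[OF order_antisym[OF le(1) ge]] by blast
  have "fst p $ i = fst (P T) $ i" "snd p $ i = snd (P T) $ i" for i
    unfolding UV(3,4) phase_power X_def Y_def using T by auto
  then have "p = P T" by (simp add: prod_eq_iff vec_eq_iff)
  then show "\<exists>T. balanced T \<and> p = P T" using T(1) unfolding balanced_def by blast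
qed

lemma Psi1_two_phase:
  assumes "balanced T"
  shows "Psi1 (Suc n) B (P T) = ereal (real (Suc n) * ln (k * L ^ (n - 1)))"
  using n two_phase_marginals[OF assms] XY_pos[of T]
  by (intro Psi1_critical[OF B _ _ phase_power(1) _ phase_power(2) two_phase_simplex[OF assms] M_pos])
    (auto intro: less_imp_le)

text \<open>The set \<open>T0\<close> witnesses that the upper bound is attained; a dominant phase
  must then reach it and falls under the equality case.\<close>

theorem dominant_iff:
  assumes "balanced (T0 :: 'q set)"
  shows "dominant_phase (Suc n) B p \<longleftrightarrow> (\<exists>T. balanced T \<and> p = P T)"
proof
  assume p: "dominant_phase (Suc n) B p"
  then have simplex: "p \<in> prob_simplex \<times> prob_simplex" by (simp add: dominant_phase_def)
  have "Psi1 (Suc n) B (P T0) \<le> Psi1 (Suc n) B p"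
    by (rule bspec[OF conjunct2[OF p[unfolded dominant_phase_def]] two_phase_simplex[OF assms]])
  from Psi1_le_max(2)[OF simplex this[unfolded Psi1_two_phase[OF assms]]]
  show "\<exists>T. balanced T \<and> p = P T" .
next
  assume "\<exists>T. balanced T \<and> p = P T"
  then obtain T where T: "balanced T" "p = P T" by blast
  show "dominant_phase (Suc n) B p"
    unfolding dominant_phase_def T(2) Psi1_two_phase[OF T(1)]
    by (intro conjI ballI two_phase_simplex[OF T(1)] Psi1_le_max(1))
qed

theorem two_phase_hessian_dominant:
  assumes bal: "balanced T" and ne: "x0 \<noteq> y0" and q: "3 \<le> CARD('q)"
  shows "hessian_dominant (Suc n) B (P T)"
proof (rule hessian_dominantI[OF B q])
  let ?M = "k * L ^ (n - 1)"
  show "0 < n" using n by simp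
  show "dominant_phase (Suc n) B (P T)" using dominant_iff[OF bal] bal by blast
  show "0 < X T i ^ n / ?M" "0 < Y T i ^ n" for i using XY_pos[of T i] M_pos by simp_all
  have marg: "(\<Sum>j\<in>UNIV. potts_int B i j * (X T i ^ n / ?M) * Y T j ^ n) = fst (P T) $ i"
    "(\<Sum>j\<in>UNIV. potts_int B j i * (X T j ^ n / ?M) * Y T i ^ n) = snd (P T) $ i" for i
  proof -
    have "(\<Sum>j\<in>UNIV. potts_int B i j * (X T i ^ n / ?M) * Y T j ^ n) = (\<Sum>j\<in>UNIV. potts_int B i j * X T i ^ n * Y T j ^ n) / ?M"
      "(\<Sum>j\<in>UNIV. potts_int B j i * (X T j ^ n / ?M) * Y T i ^ n) = (\<Sum>j\<in>UNIV. potts_int B j i * X T j ^ n * Y T i ^ n) / ?M"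
      by (simp_all add: sum_divide_distrib)
    then show "(\<Sum>j\<in>UNIV. potts_int B i j * (X T i ^ n / ?M) * Y T j ^ n) = fst (P T) $ i"
      "(\<Sum>j\<in>UNIV. potts_int B j i * (X T j ^ n / ?M) * Y T i ^ n) = snd (P T) $ i"
      unfolding two_phase_marginals[OF bal] using M_pos by (metis less_irrefl nonzero_mult_div_cancel_left)+
  qed
  then show "(\<Sum>j\<in>UNIV. potts_int B i j * (X T i ^ n / ?M) * Y T j ^ n) = fst (P T) $ i"
    "(\<Sum>j\<in>UNIV. potts_int B j i * (X T j ^ n / ?M) * Y T i ^ n) = snd (P T) $ i" for i by auto
  fix u v :: "'q \<Rightarrow> real"
  assume bu: "(\<Sum>i\<in>UNIV. fst (P T) $ i * u i) = 0" and bv: "(\<Sum>j\<in>UNIV. snd (P T) $ j * v j) = 0"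
    and nz: "\<exists>i. u i \<noteq> 0 \<or> v i \<noteq> 0"
  \<comment> \<open>Exchanging the roles of \<open>u\<close> and \<open>v\<close> outside
    \<open>T\<close> attaches \<open>\<xi>\<close> to \<open>x0\<close> and \<open>\<eta>\<close> to
    \<open>y0\<close> at every spin, so all spins carry the same form.\<close>
  define \<xi> \<eta> where "\<xi> i = (if i \<in> T then u i else v i)" and "\<eta> i = (if i \<in> T then v i else u i)" for i
  have swap: "X T i ^ m * f (u i) + Y T i ^ m * f (v i) = L ^ m * (x0 ^ m * f (\<xi> i) + y0 ^ m * f (\<eta> i))" for i m and f :: "real \<Rightarrow> real"
    by (simp add: X_def Y_def \<xi>_def \<eta>_def power_mult_distrib algebra_simps)
  have prod: "X T i ^ n * u i * (Y T i ^ n * v i) = L ^ n * L ^ n * ((x0 * y0) ^ n * \<xi> i * \<eta> i)" for i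
    by (simp add: X_def Y_def \<xi>_def \<eta>_def power_mult_distrib)
  have lin: "(\<Sum>i\<in>UNIV. X T i ^ m * u i) + (\<Sum>i\<in>UNIV. Y T i ^ m * v i)
      = L ^ m * (x0 ^ m * (\<Sum>i\<in>UNIV. \<xi> i) + y0 ^ m * (\<Sum>i\<in>UNIV. \<eta> i))" for m
    unfolding sum.distrib[symmetric] sum_distrib_left swap[of _ m "\<lambda>t. t"] ..
  have "L ^ Suc n * (x0 ^ Suc n * (\<Sum>i\<in>UNIV. \<xi> i) + y0 ^ Suc n * (\<Sum>i\<in>UNIV. \<eta> i)) = 0"
    using bu bv unfolding lin[symmetric] phase_power by simp
  then have "x0 ^ (n + 1) * (\<Sum>i\<in>UNIV. \<xi> i) + y0 ^ (n + 1) * (\<Sum>i\<in>UNIV. \<eta> i) = 0"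
    using L_pos by simp
  moreover have "\<exists>i. \<xi> i \<noteq> 0 \<or> \<eta> i \<noteq> 0" using nz unfolding \<xi>_def \<eta>_def by metis
  ultimately have qf: "(x0 ^ n * (\<Sum>i\<in>UNIV. \<xi> i) + y0 ^ n * (\<Sum>i\<in>UNIV. \<eta> i))\<^sup>2 / 2
    < (\<Sum>i\<in>UNIV. k / real n * x0 ^ (n + 1) * (\<xi> i)\<^sup>2 + k / real n * y0 ^ (n + 1) * (\<eta> i)\<^sup>2
        + 2 * (d * (x0 * y0) ^ n) * \<xi> i * \<eta> i)"
    by (rule crit_quadratic_form[OF ne Q])
  define C where "C = (\<Sum>i\<in>UNIV. (x0 * y0) ^ n * \<xi> i * \<eta> i)"
  define R where "R = (\<Sum>i\<in>UNIV. x0 ^ (n + 1) * (\<xi> i)\<^sup>2 + y0 ^ (n + 1) * (\<eta> i)\<^sup>2)"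
  define E where "E = x0 ^ n * (\<Sum>i\<in>UNIV. \<xi> i) + y0 ^ n * (\<Sum>i\<in>UNIV. \<eta> i)"
  have "(\<Sum>i\<in>UNIV. k / real n * x0 ^ (n + 1) * (\<xi> i)\<^sup>2 + k / real n * y0 ^ (n + 1) * (\<eta> i)\<^sup>2
        + 2 * (d * (x0 * y0) ^ n) * \<xi> i * \<eta> i) = k / real n * R + 2 * d * C"
    unfolding R_def C_def sum_distrib_left sum.distrib[symmetric] by (intro sum.cong refl) (simp add: algebra_simps)
  then have "E\<^sup>2 / 2 < k / real n * R + 2 * d * C" using qf unfolding E_def by (simp only:)
  then have qf': "E\<^sup>2 / 2 - 2 * d * C < k / real n * R" by linarith
  define F where "F = (\<Sum>i\<in>UNIV. \<Sum>j\<in>UNIV. potts_int B i j * (X T i ^ n * u i) * (Y T j ^ n * v j))"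
  have "2 * F \<le> L ^ n * L ^ n * (E\<^sup>2 / 2 - 2 * d * C)"
  proof -
    let ?U = "\<Sum>i\<in>UNIV. X T i ^ n * u i" and ?V = "\<Sum>i\<in>UNIV. Y T i ^ n * v i"
    have "F = ?U * ?V - d * (L ^ n * L ^ n * C)"
      unfolding F_def potts_bilinear prod C_def sum_distrib_left ..
    \<comment> \<open>The infinitesimal AM-GM step: the product of the two linear forms becomes the
      square of \<open>E\<close>, which depends only on the totals of \<open>\<xi>\<close> and
      \<open>\<eta>\<close>.\<close>
    moreover have "4 * (?U * ?V) \<le> (?U + ?V)\<^sup>2"
      using zero_le_power2[of "?U - ?V"] by (simp add: power2_eq_square algebra_simps)
    moreover have "(?U + ?V)\<^sup>2 = L ^ n * L ^ n * E\<^sup>2"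
      unfolding lin E_def by (simp add: power_mult_distrib power2_eq_square)
    ultimately show ?thesis by (simp add: algebra_simps)
  qed
  also have "\<dots> < L ^ n * L ^ n * (k / real n * R)"
    using qf' L_pos by (intro mult_strict_left_mono) auto
  also have "\<dots> = ?M * (L ^ Suc n * R) / real n"
    using n by (cases n) (simp_all add: mult_ac)
  finally have "2 * real n * F < ?M * (L ^ Suc n * R)"
    using n by (simp add: field_simps)
  then have "2 * real n * (F / ?M) < L ^ Suc n * R"
    using M_pos by (simp add: pos_divide_less_eq mult.commute)
  moreover have "F / ?M = (\<Sum>i\<in>UNIV. \<Sum>j\<in>UNIV. potts_int B i j * (X T i ^ n / ?M) * Y T j ^ n * (u i * v j))"
    unfolding F_def sum_divide_distrib by (intro sum.cong refl) simp
  moreover have "L ^ Suc n * R = (\<Sum>i\<in>UNIV. fst (P T) $ i * (u i)\<^sup>2) + (\<Sum>j\<in>UNIV. snd (P T) $ j * (v j)\<^sup>2)"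
    unfolding phase_power sum.distrib[symmetric] swap[of _ "Suc n" "\<lambda>t. t\<^sup>2"] R_def sum_distrib_left by simp
  ultimately show "2 * real n * (\<Sum>i\<in>UNIV. \<Sum>j\<in>UNIV. potts_int B i j * (X T i ^ n / ?M) * Y T j ^ n * (u i * v j))
      < (\<Sum>i\<in>UNIV. fst (P T) $ i * (u i)\<^sup>2) + (\<Sum>j\<in>UNIV. snd (P T) $ j * (v j)\<^sup>2)"
    by (simp only:)
qed

end

end

section \<open>The two regimes of the threshold\<close>

theorem theorem5:
  fixes \<Delta> :: nat and B :: real
  assumes "CARD('q::finite) \<ge> 3" and "0 \<le> B" and "B < 1" and "\<Delta> \<ge> 3"
  shows
   "(B \<ge> (real \<Delta> - real CARD('q)) / real \<Delta> \<longrightarrow>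
       (\<exists>!p :: 'q phase. dominant_phase \<Delta> B p) \<and>
       (\<forall>p :: 'q phase. dominant_phase \<Delta> B p \<longrightarrow> fst p = snd p))
    \<and>
    (even CARD('q) \<and> CARD('q) \<ge> 4 \<and> B < (real \<Delta> - real CARD('q)) / real \<Delta> \<longrightarrow>
       (\<exists>a b :: real. a \<noteq> b \<and>
          bij_betw (\<lambda>T. ((\<chi> i. if i \<in> T then a else b), (\<chi> i. if i \<in> T then b else a)) :: 'q phase)
            {T :: 'q set. card T = CARD('q) div 2} {p. dominant_phase \<Delta> B p} \<and>
          (\<forall>T :: 'q set. card T = CARD('q) div 2 \<longrightarrow>
             hessian_dominant \<Delta> B ((\<chi> i. if i \<in> T then a else b), (\<chi> i. if i \<in> T then b else a)))))"
proof (intro conjI impI; (elim conjE)?)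
  let ?Q = "real CARD('q)"
  obtain n where \<Delta>: "\<Delta> = Suc n" and n: "2 \<le> n" using assms(4) by (cases \<Delta>) auto
  have d: "0 < 1 - B" "1 - B \<le> 1" using assms by auto
  have thr: "(real \<Delta> - ?Q) / real \<Delta> \<le> B \<longleftrightarrow> (1 - B) * real (n + 1) \<le> ?Q"
    by (simp add: \<Delta> field_simps)
  {
    assume "(real \<Delta> - ?Q) / real \<Delta> \<le> B"
    then obtain k s where "crit_pair n (1 - B) k s s" and Q: "?Q * (s ^ n + s ^ n) = 2"
      using crit_pair_diagonal[OF n d(1), of ?Q] thr by auto
    then interpret crit_pair n "1 - B" k s s by simp
    define c where "c = (len ?Q * s) ^ Suc n"
    \<comment> \<open>In the diagonal case every set is balanced, so the empty set serves as
      witness.\<close>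
    have dom: "dominant_phase \<Delta> B p \<longleftrightarrow> (\<exists>T :: 'q set. p = two_phase c c T)" for p :: "'q phase"
      unfolding \<Delta> c_def using dominant_iff[OF refl assms(2) Q, of "{}" p] by (simp add: balanced_def)
    have const: "two_phase c c T = ((\<chi> i. c), (\<chi> i. c))" for T :: "'q set" by (simp add: two_phase_def)
    show "\<exists>!p :: 'q phase. dominant_phase \<Delta> B p" unfolding dom const by simp
    show "\<forall>p :: 'q phase. dominant_phase \<Delta> B p \<longrightarrow> fst p = snd p" unfolding dom const by simp
  }
  assume q: "even CARD('q)" "4 \<le> CARD('q)" and "B < (real \<Delta> - ?Q) / real \<Delta>"
  then have "?Q < (1 - B) * real (n + 1)" using thr by linarith
  then obtain k x y where "crit_pair n (1 - B) k x y" and yx: "y < x" and Q: "?Q * (x ^ n + y ^ n) = 2"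
    using crit_pair_off_diagonal[OF n d, of ?Q] q by auto
  then interpret crit_pair n "1 - B" k x y by simp
  define a b where "a = (len ?Q * x) ^ Suc n" and "b = (len ?Q * y) ^ Suc n"
  have ab: "a \<noteq> b"
    using yx y0 len_pos[OF _ Q] unfolding a_def b_def
    by (subst power_eq_iff_eq_base) (auto simp del: power_Suc)
  have bal: "balanced T \<longleftrightarrow> card T = CARD('q) div 2" for T :: "'q set"
    using q yx by (auto simp: balanced_def)
  have eq: "((\<chi> i. if i \<in> T then a else b), (\<chi> i. if i \<in> T then b else a)) = two_phase a b T" for T :: "'q set"
    by (simp add: two_phase_def)
  obtain T0 :: "'q set" where T0: "balanced T0"
    unfolding bal using obtain_subset_with_card_n[of "CARD('q) div 2" "UNIV :: 'q set"] by auto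
  have dom: "dominant_phase \<Delta> B p \<longleftrightarrow> (\<exists>T :: 'q set. card T = CARD('q) div 2 \<and> p = two_phase a b T)" for p :: "'q phase"
    unfolding \<Delta> a_def b_def bal[symmetric] by (rule dominant_iff[OF refl assms(2) Q T0])
  show "\<exists>a b :: real. a \<noteq> b \<and>
      bij_betw (\<lambda>T. ((\<chi> i. if i \<in> T then a else b), (\<chi> i. if i \<in> T then b else a)) :: 'q phase)
        {T :: 'q set. card T = CARD('q) div 2} {p. dominant_phase \<Delta> B p} \<and>
      (\<forall>T :: 'q set. card T = CARD('q) div 2 \<longrightarrow>
         hessian_dominant \<Delta> B ((\<chi> i. if i \<in> T then a else b), (\<chi> i. if i \<in> T then b else a)))"
  proof (rule exI[of _ a], rule exI[of _ b], intro conjI ab allI impI)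
    have "inj (two_phase a b :: 'q set \<Rightarrow> 'q phase)"
    proof (rule injI)
      fix S T :: "'q set"
      assume "two_phase a b S = two_phase a b T"
      then have "(if i \<in> S then a else b) = (if i \<in> T then a else b)" for i
        by (simp add: two_phase_def vec_eq_iff)
      then show "S = T" using ab by (metis subsetI subset_antisym)
    qed
    then show "bij_betw (\<lambda>T. ((\<chi> i. if i \<in> T then a else b), (\<chi> i. if i \<in> T then b else a)) :: 'q phase)
        {T :: 'q set. card T = CARD('q) div 2} {p. dominant_phase \<Delta> B p}"
      unfolding eq dom by (auto simp: bij_betw_def intro: inj_on_subset)
    fix T :: "'q set"
    assume "card T = CARD('q) div 2"
    then show "hessian_dominant \<Delta> B ((\<chi> i. if i \<in> T then a else b), (\<chi> i. if i \<in> T then b else a))"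
      unfolding eq unfolding \<Delta> a_def b_def bal[symmetric] using yx
      by (intro two_phase_hessian_dominant[OF refl assms(2) Q _ _ assms(1)]) auto
  qed
qed

end
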